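(* Let $M\in\mathbb{N}$, let $w_1,w_{21},w_{22}\in\mathbb{N}$ with $\frac{2\pi}{w_{22}}<\frac{2\pi}{w_{21}}\le\frac{2\pi}{w_1}$, and let $f_1:\mathbb{R}\to\mathbb{R}$ be a differentiable function that is periodic with cycle length $\frac{2\pi}{w_1}$ (so $f_1'$ is defined everywhere). Let $T$ be a nonempty finite subset of $[0,\frac{2\pi}{w_1}]$. Put $\tau_1=\frac{2\pi}{w_{21}(M+1)}$, $\tau_2=\frac{2\pi}{w_{22}(M+1)}$, and \[X_j=\{\big(f_1(t),f_1(t+\tau_j),\dots,f_1(t+M\tau_j)\big)^T : t\in T\}\subset\mathbb{R}^{M+1},\quad j=1,2.\] Let $\mathrm{dgm}_1(X_j)$ be the 1-dimensional persistence diagram of the Vietoris–Rips filtration on $X_j$ (Euclidean metric), $\mathrm{mp}(\mathrm{dgm}_1(X_j))$ the maximum persistence (death minus birth) of a point of this diagram, and $\mathrm{score}(f_1|f_{2j})=\mathrm{mp}(\mathrm{dgm}_1(X_j))/\sqrt{3}$. Write $\Delta=\left|\frac{2\pi}{w_{21}}-\frac{2\pi}{w_{22}}\right|$. Then there exist $t\in T$ and points $c_i\in(t+(i-1)\tau_2,\,t+(i-1)\tau_1)$, $i=2,\dots,M+1$, such that, with $S=\sqrt{\sum_{i=2}^{M+1}|f_1'(c_i)|^2}$, \begin{align*} d_H(X_1,X_2)&\le \sqrt{M+1}\,\Delta\, S,\\ d_B(\mathrm{dgm}_1(X_1),\mathrm{dgm}_1(X_2))&\le 2\sqrt{M+1}\,\Delta\,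 S,\\ |\mathrm{mp}(\mathrm{dgm}_1(X_1))-\mathrm{mp}(\mathrm{dgm}_1(X_2))|&\le 4\sqrt{M+1}\,\Delta\, S,\\ |\mathrm{score}(f_1|f_{21})-\mathrm{score}(f_1|f_{22})|&\le 4\sqrt{\tfrac{M+1}{3}}\,\Delta\, S. \end{align*}
   Context: $d_H$ is the Hausdorff distance between subsets of $\mathbb{R}^{M+1}$: $d_H(X,Y)=\inf\{\epsilon>0: X\subseteq Y^\epsilon, Y\subseteq X^\epsilon\}$, where $X^\epsilon$ is the union of open $\epsilon$-balls about points of $X$. $d_B$ is the bottleneck distance: $d_B(D,D')=\inf_\phi\sup_x\|x-\phi(x)\|_\infty$ over bijections $\phi$ between the diagrams (each augmented by points of the diagonal). The set $X_j$ is the "conditional sliding windows embedding" of $f_1$ given a series $f_{2j}$ of cycle length $\frac{2\pi}{w_{2j}}$, and $\mathrm{score}(f_1|f_{2j})$ its "conditional periodicity score". *)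

theory Defs
  imports "HOL-Analysis.Analysis" "HOL-Library.Z2" "HOL-Library.Multiset"
          "HOL-Library.Function_Algebras"
begin

text \<open>A point of R^(M+1) is represented by a function nat => real whose
  coordinates 0..M are the M+1 components (coordinates > M are ignored / set to 0).\<close>

definition eucl_dist :: "nat \<Rightarrow> (nat \<Rightarrow> real) \<Rightarrow> (nat \<Rightarrow> real) \<Rightarrow> real" where
  "eucl_dist M x y = sqrt (\<Sum>i\<le>M. (x i - y i)\<^sup>2)"

definition thicken :: "nat \<Rightarrow> (nat \<Rightarrow> real) set \<Rightarrow> real \<Rightarrow> (nat \<Rightarrow> real) set" where
  "thicken M X e = {y. \<exists>x\<in>X. eucl_dist M x y < e}"

definition hausdorff_dist :: "nat \<Rightarrow> (nat \<Rightarrow> real) set \<Rightarrow> (nat \<Rightarrow> real) set \<Rightarrow> real" where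
  "hausdorff_dist M X Y = Inf {e. e > 0 \<and> X \<subseteq> thicken M Y e \<and> Y \<subseteq> thicken M X e}"

definition sw_embed :: "(real \<Rightarrow> real) \<Rightarrow> real \<Rightarrow> nat \<Rightarrow> real \<Rightarrow> (nat \<Rightarrow> real)" where
  "sw_embed f \<tau> M t = (\<lambda>i. if i \<le> M then f (t + real i * \<tau>) else 0)"

definition vr_simplex :: "'p set \<Rightarrow> ('p \<Rightarrow> 'p \<Rightarrow> real) \<Rightarrow> real \<Rightarrow> 'p set \<Rightarrow> bool" where
  "vr_simplex P d r \<sigma> \<longleftrightarrow> \<sigma> \<noteq> {} \<and> finite \<sigma> \<and> \<sigma> \<subseteq> P \<and> (\<forall>x\<in>\<sigma>. \<forall>y\<in>\<sigma>. d x y \<le> r)"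

definition chains :: "'p set \<Rightarrow> ('p \<Rightarrow> 'p \<Rightarrow> real) \<Rightarrow> real \<Rightarrow> nat \<Rightarrow> ('p set \<Rightarrow> bit) set" where
  "chains P d r k = {c. \<forall>\<sigma>. c \<sigma> \<noteq> 0 \<longrightarrow> vr_simplex P d r \<sigma> \<and> card \<sigma> = k + 1}"

definition boundary :: "'p set \<Rightarrow> nat \<Rightarrow> ('p set \<Rightarrow> bit) \<Rightarrow> ('p set \<Rightarrow> bit)" where
  "boundary P k c = (\<lambda>\<tau>. if \<tau> \<subseteq> P \<and> card \<tau> = k \<and> \<tau> \<noteq> {}
       then (\<Sum>\<sigma>\<in>{\<sigma>. \<sigma> \<subseteq> P \<and> card \<sigma> = k + 1 \<and> \<tau> \<subseteq> \<sigma>}. c \<sigma>) else 0)"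

definition cycles1 :: "'p set \<Rightarrow> ('p \<Rightarrow> 'p \<Rightarrow> real) \<Rightarrow> real \<Rightarrow> ('p set \<Rightarrow> bit) set" where
  "cycles1 P d r = {c \<in> chains P d r 1. boundary P 1 c = 0}"

definition boundaries1 :: "'p set \<Rightarrow> ('p \<Rightarrow> 'p \<Rightarrow> real) \<Rightarrow> real \<Rightarrow> ('p set \<Rightarrow> bit) set" where
  "boundaries1 P d r = boundary P 2 ` chains P d r 2"

definition zdim :: "('p set \<Rightarrow> bit) set \<Rightarrow> nat" where
  "zdim V = vector_space.dim (\<lambda>(a::bit) (f::'p set \<Rightarrow> bit). (\<lambda>x. a * f x)) V"

text \<open>Rank of the map H_1(VR_r) -> H_1(VR_s) induced by inclusion (r <= s):
  dim Z_1(r) - dim (Z_1(r) \<inter> B_1(s)).\<close>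

definition pers_rank1 :: "'p set \<Rightarrow> ('p \<Rightarrow> 'p \<Rightarrow> real) \<Rightarrow> real \<Rightarrow> real \<Rightarrow> nat" where
  "pers_rank1 P d r s = zdim (cycles1 P d r) - zdim (cycles1 P d r \<inter> boundaries1 P d s)"

definition crit_vals :: "'p set \<Rightarrow> ('p \<Rightarrow> 'p \<Rightarrow> real) \<Rightarrow> real list" where
  "crit_vals P d = sorted_list_of_set ({0} \<union> {d x y | x y. x \<in> P \<and> y \<in> P})"

text \<open>Multiplicity of the point (a_i, a_j), i < j, in the 1-dim diagram
  (inclusion-exclusion of persistent Betti numbers; index -1 means rank 0).\<close>

definition dgm_mult1 :: "'p set \<Rightarrow> ('p \<Rightarrow> 'p \<Rightarrow> real) \<Rightarrow> nat \<Rightarrow> nat \<Rightarrow> int" where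
  "dgm_mult1 P d i j =
     (let a = crit_vals P d;
          \<beta> = (\<lambda>i j. int (pers_rank1 P d (a ! i) (a ! j)));
          \<beta>' = (\<lambda>i j. if i = 0 then 0 else \<beta> (i - 1) j)
      in \<beta> i (j - 1) - \<beta> i j - \<beta>' i (j - 1) + \<beta>' i j)"

text \<open>The 1-dimensional persistence diagram (multiset of (birth, death) pairs).
  No essential classes occur: at the largest critical value VR is the full
  simplex on P, whose H_1 vanishes.\<close>

definition dgm1 :: "'p set \<Rightarrow> ('p \<Rightarrow> 'p \<Rightarrow> real) \<Rightarrow> (real \<times> real) multiset" where
  "dgm1 P d = (let a = crit_vals P d in
     (\<Sum>(i, j)\<in>{(i, j). i < j \<and> j < length a}.
         replicate_mset (nat (dgm_mult1 P d i j)) (a ! i, a ! j)))"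

definition max_pers :: "(real \<times> real) multiset \<Rightarrow> real" where
  "max_pers D = (if D = {#} then 0 else Max ((\<lambda>(b, e). e - b) ` set_mset D))"

definition linf :: "real \<times> real \<Rightarrow> real \<times> real \<Rightarrow> real" where
  "linf x y = max \<bar>fst x - fst y\<bar> \<bar>snd x - snd y\<bar>"

definition diag_dist :: "real \<times> real \<Rightarrow> real" where
  "diag_dist x = \<bar>snd x - fst x\<bar> / 2"

definition partial_matching ::
  "(real \<times> real) multiset \<Rightarrow> (real \<times> real) multiset \<Rightarrow> ((real \<times> real) \<times> (real \<times> real)) multiset \<Rightarrow> bool" where
  "partial_matching D D' Mt \<longleftrightarrow> image_mset fst Mt \<subseteq># D \<and> image_mset snd Mt \<subseteq># D'"

definition matching_cost ::
  "(real \<times> real) multiset \<Rightarrow> (real \<times> real) multiset \<Rightarrow> ((real \<times> real) \<times> (real \<times> real)) multiset \<Rightarrow> real" where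
  "matching_cost D D' Mt =
     Max ({0} \<union> (\<lambda>(x, y). linf x y) ` set_mset Mt
              \<union> diag_dist ` set_mset (D - image_mset fst Mt)
              \<union> diag_dist ` set_mset (D' - image_mset snd Mt))"

definition bottleneck_dist :: "(real \<times> real) multiset \<Rightarrow> (real \<times> real) multiset \<Rightarrow> real" where
  "bottleneck_dist D D' = Inf {matching_cost D D' Mt | Mt. partial_matching D D' Mt}"

definition cond_sw_embedding :: "(real \<Rightarrow> real) \<Rightarrow> real \<Rightarrow> nat \<Rightarrow> real set \<Rightarrow> (nat \<Rightarrow> real) set" where
  "cond_sw_embedding f \<tau> M T = sw_embed f \<tau> M ` T"

definition dgm1_pc :: "nat \<Rightarrow> (nat \<Rightarrow> real) set \<Rightarrow> (real \<times> real) multiset" where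
  "dgm1_pc M X = dgm1 X (eucl_dist M)"

definition cond_score :: "(real \<Rightarrow> real) \<Rightarrow> real \<Rightarrow> nat \<Rightarrow> real set \<Rightarrow> real" where
  "cond_score f \<tau> M T = max_pers (dgm1_pc M (cond_sw_embedding f \<tau> M T)) / sqrt 3"

end

theory Submission
  imports Defs
begin

text \<open>The diagram of a filtration is controlled by its ranks, and if \<open>d = \<phi> \<circ> h\<close> with \<open>\<phi>\<close> monotone
  then the diagram of \<open>d\<close> is the image of that of \<open>h\<close> under \<open>\<phi> \<times> \<phi>\<close>, diagonal points removed. Two
  distance functions on the same points that never order two values strictly oppositely both factor
  in this way through their sum, so their diagrams are matched point by point within the sup distance
  of the two functions. Cutting the straight line between arbitrary distance functions at the crossings
  of values reduces the general case to this one. Point clouds at Hausdorff distance at most \<open>\<epsilon>\<close> are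
  brought to the same point set by duplicating points, which does not change the diagram; the distances
  then differ by at most \<open>2 \<epsilon>\<close>. Finally \<open>\<epsilon>\<close> is estimated with the mean value theorem at the point
  \<open>t \<in> T\<close> where the two embeddings are farthest apart.\<close>

section \<open>Finite vector spaces over the two-element field\<close>

declare add_bit_eq_xor [simp del] mult_bit_eq_and [simp del]

text \<open>The scalar multiplication hidden inside \<open>zdim\<close>, named so that the vector
  space locale can be interpreted for it.\<close>

definition chain_scale :: "bit \<Rightarrow> ('p set \<Rightarrow> bit) \<Rightarrow> ('p set \<Rightarrow> bit)" where
  "chain_scale = (\<lambda>a f x. a * f x)"

global_interpretation chain_space: vector_space chain_scale
  by unfold_locales (auto simp: chain_scale_def fun_eq_iff algebra_simps)

lemma chain_scale_simps [simp]: "chain_scale 0 c = 0" "chain_scale 1 c = c"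
  by (auto simp: chain_scale_def fun_eq_iff)

lemma zdim_eq_dim: "zdim V = chain_space.dim V"
  by (simp only: zdim_def chain_scale_def)

lemma chain_add_self [simp]: "c + c = (0 :: 'p set \<Rightarrow> bit)"
  by (simp add: fun_eq_iff flip: mult_2)

lemma chain_add_self_left [simp]: "c + (c + e) = (e :: 'p set \<Rightarrow> bit)"
  by (simp flip: add.assoc)

lemma chain_uminus [simp]: "- c = (c :: 'p set \<Rightarrow> bit)"
  by (metis chain_add_self minus_unique)

lemma chain_minus [simp]: "c - e = c + (e :: 'p set \<Rightarrow> bit)"
  by (metis chain_uminus diff_conv_add_uminus)

text \<open>The only scalars are 0 and 1, so closure under scaling comes for free.\<close>

lemma subspace_chainI:
  assumes "0 \<in> V" "\<And>c e. c \<in> V \<Longrightarrow> e \<in> V \<Longrightarrow> c + e \<in> V"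
  shows "chain_space.subspace V"
proof (rule chain_space.subspaceI)
  fix a :: bit and c assume "c \<in> V"
  show "chain_scale a c \<in> V" using assms(1) \<open>c \<in> V\<close> by (cases a) simp_all
qed (use assms in auto)

text \<open>Adjoining an independent vector doubles the span: the new span is the disjoint union of
  the old one and its translate.\<close>

lemma card_span_independent:
  assumes "finite B" "\<not> chain_space.dependent B"
  shows "finite (chain_space.span B) \<and> card (chain_space.span B) = 2 ^ card B"
  using assms
proof (induction B)
  case empty
  then show ?case by simp
next
  case (insert a B)
  then have a: "a \<notin> chain_space.span B" and B: "\<not> chain_space.dependent B"
    by (auto simp: chain_space.independent_insert)
  let ?S = "chain_space.span B"
  have "chain_space.span (insert a B) = ?S \<union> (\<lambda>x. x + a) ` ?S"
  proof (intro set_eqI iffI)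
    fix x assume "x \<in> chain_space.span (insert a B)"
    then obtain k where k: "x - chain_scale k a \<in> ?S"
      by (auto simp: chain_space.span_insert)
    show "x \<in> ?S \<union> (\<lambda>x. x + a) ` ?S"
    proof (cases "k = 0")
      case True
      then show ?thesis using k by simp
    next
      case False
      then have "x + a \<in> ?S" using k by simp
      then have "(x + a) + a \<in> (\<lambda>x. x + a) ` ?S" by blast
      then show ?thesis by (simp add: add.assoc)
    qed
  next
    fix x assume "x \<in> ?S \<union> (\<lambda>x. x + a) ` ?S"
    then show "x \<in> chain_space.span (insert a B)"
      using chain_space.span_mono[of B "insert a B"] chain_space.span_base[of a "insert a B"]
      by (blast intro: chain_space.span_add)
  qed
  moreover have "?S \<inter> (\<lambda>x. x + a) ` ?S = {}"
  proof -
    have False if "x \<in> ?S" "x + a \<in> ?S" for x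
      using chain_space.span_add[OF that] a by (simp add: add.assoc[symmetric])
    then show ?thesis by auto
  qed
  moreover have "card ((\<lambda>x. x + a) ` ?S) = card ?S"
    by (rule card_image) (auto simp: inj_on_def)
  ultimately show ?case using insert B by (simp add: card_Un_disjoint)
qed

text \<open>Turns dimension identities for finite spaces into counting.\<close>

lemma card_eq_power_zdim:
  assumes "chain_space.subspace V" "finite V"
  shows "card V = 2 ^ zdim V"
proof -
  obtain B where B: "B \<subseteq> V" "\<not> chain_space.dependent B" "V \<subseteq> chain_space.span B"
      "card B = chain_space.dim V"
    using chain_space.basis_exists .
  have "chain_space.span B = V"
    using B assms(1) by (simp add: chain_space.span_minimal subset_antisym)
  moreover have "finite B" using B(1) assms(2) finite_subset by blast
  ultimately show ?thesis using card_span_independent[of B] B by (simp add: zdim_eq_dim)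
qed

lemma zdim_mono:
  assumes "chain_space.subspace V" "chain_space.subspace W" "finite W" "V \<subseteq> W"
  shows "zdim V \<le> zdim W"
proof -
  have "card V \<le> card W" using assms by (simp add: card_mono)
  then show ?thesis
    using card_eq_power_zdim[of V] card_eq_power_zdim[of W] assms finite_subset by fastforce
qed

abbreviation subspace_sum (infixl "\<oplus>" 65) where
  "V \<oplus> W \<equiv> {x + y | x y. x \<in> V \<and> y \<in> W}"

text \<open>Every fibre of the addition map on \<open>V \<times> W\<close> is a coset of a copy of
  \<open>V \<inter> W\<close>: it consists of the pairs \<open>(x + u, y + u)\<close>, because signs
  do not matter in characteristic two. Counting \<open>V \<times> W\<close> by fibres gives the
  dimension formula.\<close>

lemma zdim_sum_Int:
  fixes V W :: "('p set \<Rightarrow> bit) set"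
  assumes V: "chain_space.subspace V" "finite V" and W: "chain_space.subspace W" "finite W"
  shows "zdim (V \<oplus> W) + zdim (V \<inter> W) = zdim V + zdim W"
proof -
  let ?f = "\<lambda>(x, y). x + y :: 'p set \<Rightarrow> bit"
  have im: "?f ` (V \<times> W) = V \<oplus> W" by auto
  have fin: "finite (V \<oplus> W)" using V W by (simp flip: im)
  have fibre: "card {p \<in> V \<times> W. ?f p = z} = card (V \<inter> W)" if z: "z \<in> V \<oplus> W" for z
  proof -
    obtain x y where xy: "x \<in> V" "y \<in> W" "z = x + y" using z by auto
    have "bij_betw (\<lambda>u. (x + u, y + u)) (V \<inter> W) {p \<in> V \<times> W. ?f p = z}"
    proof (rule bij_betwI[where g = "\<lambda>p. x + fst p"])
      show "(\<lambda>u. (x + u, y + u)) \<in> V \<inter> W \<rightarrow> {p \<in> V \<times> W. ?f p = z}"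
        using V(1) W(1) xy
        by (auto intro: chain_space.subspace_add simp: ac_simps)
      show "(\<lambda>p. x + fst p) \<in> {p \<in> V \<times> W. ?f p = z} \<rightarrow> V \<inter> W"
      proof
        fix p assume "p \<in> {p \<in> V \<times> W. ?f p = z}"
        then have p: "fst p \<in> V" "snd p \<in> W" "fst p + snd p = x + y"
          using xy by (auto simp: case_prod_beta)
        then have "y + snd p = x + fst p"
          by (metis ab_semigroup_add_class.add_ac(1) add.commute chain_add_self_left)
        then show "x + fst p \<in> V \<inter> W"
          using p xy V(1) W(1) by (metis IntI chain_space.subspace_add)
      qed
      show "(x + (x + fst p), y + (x + fst p)) = p" if "p \<in> {p \<in> V \<times> W. ?f p = z}" for p
      proof -
        have "x + y = fst p + snd p" using that xy by (auto simp: case_prod_beta)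
        moreover have "y + (x + fst p) = (x + y) + fst p" by (simp add: ac_simps)
        ultimately have "y + (x + fst p) = snd p" by (simp add: ac_simps)
        then show ?thesis by (simp add: prod_eq_iff add.commute add.left_commute)
      qed
    qed simp
    then show ?thesis by (simp add: bij_betw_same_card)
  qed
  have "card (V \<times> W) = (\<Sum>z\<in>V \<oplus> W. card {p \<in> V \<times> W. ?f p = z})"
    using sum.image_gen[of "V \<times> W" "\<lambda>_. 1::nat" ?f] V W by (simp add: im)
  then have "card V * card W = card (V \<oplus> W) * card (V \<inter> W)"
    using fibre by (simp add: card_cartesian_product)
  then have "(2::nat) ^ (zdim V + zdim W) = 2 ^ (zdim (V \<oplus> W) + zdim (V \<inter> W))"
    using V W fin
    by (simp add: card_eq_power_zdim chain_space.subspace_sums chain_space.subspace_inter power_add)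
  then show ?thesis by simp
qed

section \<open>Cycles, boundaries and persistent ranks\<close>

lemma boundary_add: "boundary P k (c + e) = boundary P k c + boundary P k e"
  by (auto simp: boundary_def fun_eq_iff sum.distrib)

lemma boundary_zero [simp]: "boundary P k 0 = 0"
  by (auto simp: boundary_def fun_eq_iff)

text \<open>A chain is determined by its support, a set of subsets of \<open>P\<close>.\<close>

lemma finite_chains:
  assumes "finite P" shows "finite (chains P d r k)"
proof -
  have "chains P d r k \<subseteq> (\<lambda>S \<sigma>. of_bool (\<sigma> \<in> S)) ` Pow (Pow P)"
  proof
    fix c assume c: "c \<in> chains P d r k"
    have "c = (\<lambda>\<sigma>. of_bool (\<sigma> \<in> {\<sigma>. c \<sigma> \<noteq> 0}))"
      by (auto simp: fun_eq_iff)
    moreover have "{\<sigma>. c \<sigma> \<noteq> 0} \<in> Pow (Pow P)"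
      using c unfolding chains_def vr_simplex_def by auto
    ultimately show "c \<in> (\<lambda>S \<sigma>. of_bool (\<sigma> \<in> S)) ` Pow (Pow P)" by blast
  qed
  then show ?thesis using assms finite_subset by blast
qed

lemma zero_in_chains [simp]: "0 \<in> chains P d r k"
  by (simp add: chains_def)

lemma chains_add: "c \<in> chains P d r k \<Longrightarrow> e \<in> chains P d r k \<Longrightarrow> c + e \<in> chains P d r k"
  unfolding chains_def by (simp, metis add_0 bit_not_zero_iff)

lemma chains_mono: "r \<le> s \<Longrightarrow> chains P d r k \<subseteq> chains P d s k"
  unfolding chains_def vr_simplex_def by force

lemma subspace_cycles1: "chain_space.subspace (cycles1 P d r)"
  by (rule subspace_chainI) (auto simp: cycles1_def chains_add boundary_add)

lemma subspace_boundaries1: "chain_space.subspace (boundaries1 P d r)"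
proof (rule subspace_chainI)
  show "0 \<in> boundaries1 P d r"
    unfolding boundaries1_def by (metis boundary_zero imageI zero_in_chains)
  fix c e assume "c \<in> boundaries1 P d r" "e \<in> boundaries1 P d r"
  then show "c + e \<in> boundaries1 P d r"
    unfolding boundaries1_def by (auto simp flip: boundary_add intro: chains_add)
qed

lemma finite_cycles1: "finite P \<Longrightarrow> finite (cycles1 P d r)"
  by (simp add: cycles1_def finite_chains)

lemma cycles1_mono: "r \<le> s \<Longrightarrow> cycles1 P d r \<subseteq> cycles1 P d s"
  using chains_mono[of r s P d] by (auto simp: cycles1_def)

lemma boundaries1_mono: "r \<le> s \<Longrightarrow> boundaries1 P d r \<subseteq> boundaries1 P d s"
  using chains_mono[of r s P d] by (auto simp: boundaries1_def)

text \<open>The subtracted space is a subspace of the first, so the natural number subtraction in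
  \<open>pers_rank1\<close> does not truncate.\<close>

lemma pers_rank1_int:
  assumes "finite P"
  shows "int (pers_rank1 P d r s)
    = int (zdim (cycles1 P d r)) - int (zdim (cycles1 P d r \<inter> boundaries1 P d s))"
  using zdim_mono[of "cycles1 P d r \<inter> boundaries1 P d s" "cycles1 P d r"] assms
  by (simp add: pers_rank1_def subspace_cycles1 subspace_boundaries1 finite_cycles1
      chain_space.subspace_inter of_nat_diff)

text \<open>Supermodularity of the dimension: with \<open>Z = Z\<^sub>1(r)\<close>, \<open>Z' = Z\<^sub>1(r')\<close>, \<open>B = B\<^sub>1(s)\<close>,
  \<open>B' = B\<^sub>1(s')\<close>, the space \<open>Z' \<inter> B'\<close> contains \<open>Z \<inter> B'\<close> and \<open>Z' \<inter> B\<close>, which meet in \<open>Z \<inter> B\<close>.\<close>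

lemma pers_rank1_supermodular:
  assumes P: "finite P" and "r \<le> r'" "s \<le> s'"
  shows "int (pers_rank1 P d r s) + int (pers_rank1 P d r' s')
    \<le> int (pers_rank1 P d r' s) + int (pers_rank1 P d r s')"
proof -
  let ?Z = "cycles1 P d" and ?B = "boundaries1 P d"
  have sub: "chain_space.subspace (?Z u \<inter> ?B v)" and fin: "finite (?Z u \<inter> ?B v)" for u v
    using P by (simp_all add: subspace_cycles1 subspace_boundaries1 finite_cycles1 chain_space.subspace_inter)
  have Z: "?Z r \<subseteq> ?Z r'" and B: "?B s \<subseteq> ?B s'"
    using assms cycles1_mono boundaries1_mono by blast+
  have "(?Z r \<inter> ?B s') \<oplus> (?Z r' \<inter> ?B s) \<subseteq> ?Z r' \<inter> ?B s'"
  proof -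
    have "?Z r \<inter> ?B s' \<subseteq> ?Z r' \<inter> ?B s'" "?Z r' \<inter> ?B s \<subseteq> ?Z r' \<inter> ?B s'"
      using Z B by blast+
    then show ?thesis using chain_space.subspace_add[OF sub[of r' s']] by blast
  qed
  then have "zdim ((?Z r \<inter> ?B s') \<oplus> (?Z r' \<inter> ?B s)) \<le> zdim (?Z r' \<inter> ?B s')"
    by (intro zdim_mono chain_space.subspace_sums sub fin)
  moreover have "(?Z r \<inter> ?B s') \<inter> (?Z r' \<inter> ?B s) = ?Z r \<inter> ?B s"
    using Z B by blast
  ultimately have "zdim (?Z r \<inter> ?B s') + zdim (?Z r' \<inter> ?B s) \<le> zdim (?Z r' \<inter> ?B s') + zdim (?Z r \<inter> ?B s)"
    using zdim_sum_Int[OF sub fin sub fin, of r s' r' s] by simp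
  then show ?thesis by (simp add: pers_rank1_int[OF P])
qed

text \<open>At a later level more boundaries are divided out. This is the sign condition that
  remains of the multiplicity formula when \<open>i = 0\<close>.\<close>

lemma pers_rank1_antimono:
  assumes P: "finite P" and "s \<le> s'"
  shows "pers_rank1 P d r s' \<le> pers_rank1 P d r s"
proof -
  have "zdim (cycles1 P d r \<inter> boundaries1 P d s) \<le> zdim (cycles1 P d r \<inter> boundaries1 P d s')"
    using boundaries1_mono[OF assms(2), of P d] P
    by (intro zdim_mono chain_space.subspace_inter subspace_cycles1 subspace_boundaries1)
       (auto simp: finite_cycles1)
  then show ?thesis by (simp add: pers_rank1_def)
qed

text \<open>Chains see the distance only through \<open>vr_simplex\<close>, and
  \<open>boundary\<close> does not mention it.\<close>

lemma pers_rank1_cong: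
  assumes "\<And>\<sigma>. vr_simplex P d r \<sigma> \<longleftrightarrow> vr_simplex P d' r' \<sigma>"
    and "\<And>\<sigma>. vr_simplex P d s \<sigma> \<longleftrightarrow> vr_simplex P d' s' \<sigma>"
  shows "pers_rank1 P d r s = pers_rank1 P d' r' s'"
  using assms by (simp add: pers_rank1_def cycles1_def boundaries1_def chains_def)

section \<open>Removing a duplicated point\<close>

text \<open>Between a simplex and one with two more vertices lie exactly two intermediate simplices,
  so each coefficient is counted twice and vanishes modulo 2.\<close>

lemma boundary_boundary:
  assumes "finite P"
  shows "boundary P k (boundary P (Suc k) c) = 0"
proof
  fix \<tau>
  show "boundary P k (boundary P (Suc k) c) \<tau> = 0 \<tau>"
  proof (cases "\<tau> \<subseteq> P \<and> card \<tau> = k \<and> \<tau> \<noteq> {}")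
    case True
    let ?A = "{\<sigma>. \<sigma> \<subseteq> P \<and> card \<sigma> = k + 1 \<and> \<tau> \<subseteq> \<sigma>}"
    let ?B = "\<lambda>\<sigma>. {\<rho>. \<rho> \<subseteq> P \<and> card \<rho> = k + 2 \<and> \<sigma> \<subseteq> \<rho>}"
    have fin: "finite {\<sigma>. \<sigma> \<subseteq> P \<and> Q \<sigma>}" for Q using assms by simp
    have "boundary P (Suc k) c \<sigma> = (\<Sum>\<rho>\<in>?B \<sigma>. c \<rho>)" if "\<sigma> \<in> ?A" for \<sigma>
      using that by (cases "\<sigma> = {}") (auto simp: boundary_def)
    then have "boundary P k (boundary P (Suc k) c) \<tau> = (\<Sum>\<sigma>\<in>?A. \<Sum>\<rho>\<in>?B \<sigma>. c \<rho>)"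
      using True by (simp add: boundary_def[of P k])
    also have "\<dots> = (\<Sum>\<sigma>\<in>?A. \<Sum>\<rho>\<in>{\<rho> \<in> ?B \<tau>. \<sigma> \<subseteq> \<rho>}. c \<rho>)"
      by (auto intro!: sum.cong)
    also have "\<dots> = (\<Sum>\<rho>\<in>?B \<tau>. \<Sum>\<sigma>\<in>{\<sigma> \<in> ?A. \<sigma> \<subseteq> \<rho>}. c \<rho>)"
      by (rule sum.swap_restrict) (use fin in auto)
    also have "\<dots> = 0"
    proof (rule sum.neutral, rule ballI)
      fix \<rho> assume \<rho>: "\<rho> \<in> ?B \<tau>"
      have f: "finite \<rho>" "finite \<tau>" using \<rho> assms finite_subset True by auto
      have "card (\<rho> - \<tau>) = 2" using \<rho> True f by (simp add: card_Diff_subset)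
      then obtain u v where uv: "\<rho> - \<tau> = {u, v}" "u \<noteq> v" by (auto simp: card_2_iff)
      have "{\<sigma> \<in> ?A. \<sigma> \<subseteq> \<rho>} = {insert u \<tau>, insert v \<tau>}"
      proof (intro set_eqI iffI)
        fix \<sigma> assume "\<sigma> \<in> {\<sigma> \<in> ?A. \<sigma> \<subseteq> \<rho>}"
        then have \<sigma>: "card \<sigma> = k + 1" "\<tau> \<subseteq> \<sigma>" "\<sigma> \<subseteq> \<rho>" by auto
        then have "card (\<sigma> - \<tau>) = 1" using True f by (simp add: card_Diff_subset)
        then obtain w where "\<sigma> - \<tau> = {w}" by (auto simp: card_1_singleton_iff)
        then have "\<sigma> = insert w \<tau>" "w \<in> {u, v}" using \<sigma> uv(1) by blast+
        then show "\<sigma> \<in> {insert u \<tau>, insert v \<tau>}" by blast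
      next
        fix \<sigma> assume "\<sigma> \<in> {insert u \<tau>, insert v \<tau>}"
        then show "\<sigma> \<in> {\<sigma> \<in> ?A. \<sigma> \<subseteq> \<rho>}"
          using \<rho> uv True f by (auto simp: card_insert_if)
      qed
      moreover have "insert u \<tau> \<noteq> insert v \<tau>" using uv by auto
      ultimately show "(\<Sum>\<sigma>\<in>{\<sigma> \<in> ?A. \<sigma> \<subseteq> \<rho>}. c \<rho>) = 0" by (simp flip: mult_2)
    qed
    finally show ?thesis by simp
  qed (auto simp: boundary_def)
qed

text \<open>For \<open>x \<noteq> y\<close>, the cone with apex \<open>y\<close> over those
  simplices of \<open>c\<close> that contain \<open>x\<close> but not \<open>y\<close>.\<close>

definition cone_chain :: "'p \<Rightarrow> 'p \<Rightarrow> ('p set \<Rightarrow> bit) \<Rightarrow> ('p set \<Rightarrow> bit)" where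
  "cone_chain x y c = (\<lambda>\<sigma>. if x \<in> \<sigma> \<and> y \<in> \<sigma> then c (\<sigma> - {y}) else 0)"

text \<open>Replacing \<open>y\<close> by its duplicate \<open>x\<close> preserves all distances and
  maps a cone simplex into the simplex it was built on, so coning does not raise the level.\<close>

lemma cone_chain_in_chains:
  assumes c: "c \<in> chains P d r k" and y: "y \<in> P" "x \<noteq> y"
    and D: "\<And>z. z \<in> P \<Longrightarrow> d x z = d y z \<and> d z x = d z y"
  shows "cone_chain x y c \<in> chains P d r (Suc k)"
  unfolding chains_def
proof (intro CollectI allI impI)
  fix \<sigma> assume "cone_chain x y c \<sigma> \<noteq> 0"
  then have \<sigma>: "x \<in> \<sigma>" "y \<in> \<sigma>" "c (\<sigma> - {y}) \<noteq> 0"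
    by (auto simp: cone_chain_def split: if_splits)
  then have v: "vr_simplex P d r (\<sigma> - {y})" "card (\<sigma> - {y}) = k + 1"
    using c by (auto simp: chains_def)
  then have f: "finite \<sigma>" "\<sigma> \<subseteq> P" using y by (auto simp: vr_simplex_def)
  have "d a b \<le> r" if "a \<in> \<sigma>" "b \<in> \<sigma>" for a b
  proof -
    define p where "p z = (if z = y then x else z)" for z
    have "p a \<in> \<sigma> - {y}" "p b \<in> \<sigma> - {y}" using that \<sigma> y by (auto simp: p_def)
    then have "d (p a) (p b) \<le> r" using v by (auto simp: vr_simplex_def)
    moreover have "d (p a) (p b) = d a b"
      using D f(2) that \<sigma> y by (auto simp: p_def)
    ultimately show ?thesis by simp
  qed
  then show "vr_simplex P d r \<sigma> \<and> card \<sigma> = Suc k + 1"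
    using v f \<sigma> by (auto simp: vr_simplex_def)
qed


lemma boundary_in_chains:
  assumes "c \<in> chains P d r (Suc k)" "finite P"
  shows "boundary P (Suc k) c \<in> chains P d r k"
  unfolding chains_def
proof (intro CollectI allI impI)
  fix \<tau> assume nz: "boundary P (Suc k) c \<tau> \<noteq> 0"
  then have \<tau>: "\<tau> \<subseteq> P" "card \<tau> = Suc k" "\<tau> \<noteq> {}"
    by (auto simp: boundary_def split: if_splits)
  with nz have "(\<Sum>\<sigma>\<in>{\<sigma>. \<sigma> \<subseteq> P \<and> card \<sigma> = Suc k + 1 \<and> \<tau> \<subseteq> \<sigma>}. c \<sigma>) \<noteq> 0"
    by (simp add: boundary_def)
  then obtain \<sigma> where "\<tau> \<subseteq> \<sigma>" "c \<sigma> \<noteq> 0"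
    by (metis (mono_tags, lifting) mem_Collect_eq sum.neutral)
  then show "vr_simplex P d r \<tau> \<and> card \<tau> = k + 1"
    using assms(1) \<tau> finite_subset[OF \<tau>(1) assms(2)]
    by (auto simp: chains_def vr_simplex_def subset_eq)
qed

text \<open>Adding the boundary of the cone with apex \<open>y\<close> over the simplices containing \<open>x\<close> pushes a
  chain off its duplicated vertex \<open>x\<close>.\<close>

lemma cone_chain_push:
  assumes P: "finite P" and c: "c \<in> chains P d r k" and y: "y \<in> P" "x \<noteq> y"
    and D: "\<And>z. z \<in> P \<Longrightarrow> d x z = d y z \<and> d z x = d z y"
    and bd: "\<And>\<tau>. x \<in> \<tau> \<Longrightarrow> boundary P k c \<tau> = 0"
  shows "c + boundary P (Suc k) (cone_chain x y c) \<in> chains (P - {x}) d r k"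
proof -
  define c' where "c' = c + boundary P (Suc k) (cone_chain x y c)"
  have c': "c' \<in> chains P d r k"
    unfolding c'_def by (intro chains_add c boundary_in_chains P cone_chain_in_chains y D)
  have fin: "finite {\<sigma>. \<sigma> \<subseteq> P \<and> Q \<sigma>}" for Q using P by simp
  \<comment> \<open>The only coface of \<open>\<sigma>\<close> containing \<open>y\<close> is
    \<open>insert y \<sigma>\<close>, where the cone has coefficient \<open>c \<sigma>\<close>; this
    cancels against \<open>c \<sigma>\<close> itself.\<close>
  have off: "c' \<sigma> = 0" if \<sigma>: "\<sigma> \<subseteq> P" "card \<sigma> = k + 1" "x \<in> \<sigma>" "y \<notin> \<sigma>" for \<sigma>
  proof -
    let ?A = "{\<rho>. \<rho> \<subseteq> P \<and> card \<rho> = Suc k + 1 \<and> \<sigma> \<subseteq> \<rho>}"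
    have fs: "finite \<sigma>" using \<sigma> P finite_subset by blast
    have "\<rho> = insert y \<sigma>" if "\<rho> \<in> ?A" "y \<in> \<rho>" for \<rho>
    proof -
      have "insert y \<sigma> \<subseteq> \<rho>" "finite \<rho>" using that P finite_subset by auto
      then show ?thesis using that \<sigma> fs by (intro card_subset_eq[symmetric]) auto
    qed
    then have "(\<Sum>\<rho>\<in>?A. cone_chain x y c \<rho>) = (\<Sum>\<rho>\<in>{insert y \<sigma>}. cone_chain x y c \<rho>)"
      using fin \<sigma> y fs by (intro sum.mono_neutral_right) (auto simp: cone_chain_def)
    also have "\<dots> = c \<sigma>" using \<sigma> by (simp add: cone_chain_def)
    finally show ?thesis using \<sigma> by (auto simp: c'_def boundary_def simp flip: mult_2)
  qed
  \<comment> \<open>By \<open>off\<close>, \<open>\<sigma>\<close> is the only coface of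
    \<open>\<sigma> - {y}\<close> on which \<open>c'\<close> can be nonzero. The boundary of
    \<open>c'\<close> at that face is the boundary of \<open>c\<close>, which vanishes there by
    \<open>bd\<close>.\<close>
  have on: "c' \<sigma> = 0" if \<sigma>: "\<sigma> \<subseteq> P" "card \<sigma> = k + 1" "x \<in> \<sigma>" "y \<in> \<sigma>" for \<sigma>
  proof -
    let ?\<tau> = "\<sigma> - {y}"
    let ?A = "{\<rho>. \<rho> \<subseteq> P \<and> card \<rho> = k + 1 \<and> ?\<tau> \<subseteq> \<rho>}"
    have fs: "finite \<sigma>" using \<sigma> P finite_subset by blast
    have \<tau>: "?\<tau> \<subseteq> P" "card ?\<tau> = k" "x \<in> ?\<tau>" using \<sigma> y fs by auto
    have "\<rho> = \<sigma>" if "\<rho> \<in> ?A" "y \<in> \<rho>" for \<rho>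
    proof -
      have "\<sigma> \<subseteq> \<rho>" "finite \<rho>" using that P finite_subset by auto
      then show ?thesis using that \<sigma> fs by (intro card_subset_eq[symmetric]) auto
    qed
    then have "c' \<rho> = 0" if "\<rho> \<in> ?A - {\<sigma>}" for \<rho>
      using that off[of \<rho>] \<tau>(3) by blast
    then have "(\<Sum>\<rho>\<in>?A. c' \<rho>) = (\<Sum>\<rho>\<in>{\<sigma>}. c' \<rho>)"
      using fin \<sigma> by (intro sum.mono_neutral_right) auto
    moreover have "boundary P k c' ?\<tau> = (\<Sum>\<rho>\<in>?A. c' \<rho>)"
      using \<tau> by (auto simp: boundary_def)
    moreover have "boundary P k c' ?\<tau> = 0"
      using bd[OF \<tau>(3)] by (simp add: c'_def boundary_add boundary_boundary P)
    ultimately show ?thesis by simp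
  qed
  have "\<sigma> \<subseteq> P - {x}" if "c' \<sigma> \<noteq> 0" for \<sigma>
  proof -
    have "\<sigma> \<subseteq> P" "card \<sigma> = k + 1"
      using c' that by (auto simp: chains_def vr_simplex_def)
    then show ?thesis using on off that by blast
  qed
  then have "c' \<in> chains (P - {x}) d r k"
    using c' by (auto simp: chains_def vr_simplex_def)
  then show ?thesis by (simp add: c'_def)
qed

lemma chains_subset: "P' \<subseteq> P \<Longrightarrow> chains P' d r k \<subseteq> chains P d r k"
  unfolding chains_def vr_simplex_def by blast

text \<open>The chain vanishes on every simplex that leaves \<open>P'\<close>, so the extra cofaces
  in \<open>P\<close> contribute nothing.\<close>

lemma boundary_subset:
  fixes c :: "'p set \<Rightarrow> bit"
  assumes "finite P" "P' \<subseteq> P" "c \<in> chains P' d r k"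
  shows "boundary P' k c = boundary P k c"
proof
  fix \<tau> :: "'p set"
  have z: "c \<sigma> = 0" if "\<not> \<sigma> \<subseteq> P'" for \<sigma>
    using assms(3) that unfolding chains_def vr_simplex_def by blast
  let ?A = "\<lambda>Q. {\<sigma>. \<sigma> \<subseteq> Q \<and> card \<sigma> = k + 1 \<and> \<tau> \<subseteq> \<sigma>}"
  have "(\<Sum>\<sigma>\<in>?A P. c \<sigma>) = (\<Sum>\<sigma>\<in>?A P'. c \<sigma>)"
    using assms z by (intro sum.mono_neutral_right) auto
  moreover have "(\<Sum>\<sigma>\<in>?A P'. c \<sigma>) = 0" if "\<not> \<tau> \<subseteq> P'"
    using that by (intro sum.neutral) auto
  ultimately show "boundary P' k c \<tau> = boundary P k c \<tau>"
    using assms(2) unfolding boundary_def by (smt (verit) order_trans)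
qed

text \<open>Pushing a cycle off \<open>x\<close> changes it by a boundary, so
  \<open>Z = Z' + (Z \<inter> B)\<close>; pushing fillings off \<open>x\<close> gives
  \<open>Z' \<inter> B = Z' \<inter> B'\<close>. The dimension formula then equates the two ranks,
  as in the second isomorphism theorem.\<close>

lemma pers_rank1_remove_duplicate:
  assumes P: "finite P" and y: "y \<in> P" "x \<in> P" "x \<noteq> y"
    and D: "\<And>z. z \<in> P \<Longrightarrow> d x z = d y z \<and> d z x = d z y" and rs: "r \<le> s"
  shows "pers_rank1 P d r s = pers_rank1 (P - {x}) d r s"
proof -
  let ?P = "P - {x}"
  let ?Z = "cycles1 P d r" and ?Z' = "cycles1 ?P d r"
  let ?B = "boundaries1 P d s" and ?B' = "boundaries1 ?P d s"
  have sub: "?P \<subseteq> P" by blast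
  have bd: "boundary ?P k c = boundary P k c" if "c \<in> chains ?P d u k" for c u k
    using boundary_subset[OF P sub that] .
  have ZZ: "?Z' \<subseteq> ?Z"
    using bd chains_subset[OF sub] unfolding cycles1_def by fastforce
  have BB: "?B' \<subseteq> ?B"
    using bd chains_subset[OF sub] unfolding boundaries1_def by fastforce
  have "?Z = ?Z' \<oplus> (?Z \<inter> ?B)"
  proof
    show "?Z' \<oplus> (?Z \<inter> ?B) \<subseteq> ?Z"
      using ZZ chain_space.subspace_add[OF subspace_cycles1] by blast
    show "?Z \<subseteq> ?Z' \<oplus> (?Z \<inter> ?B)"
    proof
      fix z assume z: "z \<in> ?Z"
      then have zc: "z \<in> chains P d r 1" and z0: "boundary P 1 z = 0"
        by (auto simp: cycles1_def)
      \<comment> \<open>The cone over \<open>z\<close> lives at level \<open>r\<close>, hence also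
        at \<open>s\<close>, so the correction \<open>b\<close> is a boundary at level
        \<open>s\<close>.\<close>
      define b where "b = boundary P 2 (cone_chain x y z)"
      have "z + b \<in> chains ?P d r 1"
        using cone_chain_push[OF P zc y(1,3) D] z0 by (simp add: b_def numeral_2_eq_2)
      moreover have "boundary P 1 (z + b) = 0"
        using z0 boundary_boundary[OF P, of 1] by (simp add: b_def boundary_add numeral_2_eq_2)
      ultimately have "z + b \<in> ?Z'" using bd by (simp add: cycles1_def)
      moreover have "cone_chain x y z \<in> chains P d s 2"
        using cone_chain_in_chains[OF zc y(1,3) D] chains_mono[OF rs]
        by (auto simp: numeral_2_eq_2)
      then have "b \<in> ?B" by (auto simp: b_def boundaries1_def)
      moreover have "z + (z + b) \<in> ?Z"
        by (rule chain_space.subspace_add[OF subspace_cycles1 z subsetD[OF ZZ \<open>z + b \<in> ?Z'\<close>]])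
      then have "b \<in> ?Z" by simp
      moreover have "z = (z + b) + b" by (simp add: add.assoc)
      ultimately show "z \<in> ?Z' \<oplus> (?Z \<inter> ?B)" by blast
    qed
  qed
  moreover have "?Z' \<inter> ?B \<subseteq> ?B'"
  proof
    fix c assume "c \<in> ?Z' \<inter> ?B"
    then obtain b where c: "c \<in> chains ?P d r 1" and b: "b \<in> chains P d s 2" "c = boundary P 2 b"
      by (auto simp: cycles1_def boundaries1_def)
    \<comment> \<open>The boundary of the filling \<open>b\<close> is \<open>c\<close>, which avoids
      \<open>x\<close>; so \<open>b\<close> itself can be pushed off \<open>x\<close>, and its
      boundary remains \<open>c\<close>.\<close>
    have "boundary P 2 b \<tau> = 0" if "x \<in> \<tau>" for \<tau>
      using c that unfolding b(2)[symmetric] chains_def vr_simplex_def by blast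
    from cone_chain_push[OF P b(1) y(1,3) D this]
    have b': "b + boundary P (Suc 2) (cone_chain x y b) \<in> chains ?P d s 2" by simp
    moreover have "boundary ?P 2 (b + boundary P (Suc 2) (cone_chain x y b)) = c"
      using bd[OF b'] boundary_boundary[OF P, of 2] b by (simp add: boundary_add)
    ultimately show "c \<in> ?B'" unfolding boundaries1_def by blast
  qed
  then have "?Z' \<inter> (?Z \<inter> ?B) = ?Z' \<inter> ?B'" using ZZ BB by blast
  ultimately have "zdim ?Z + zdim (?Z' \<inter> ?B') = zdim ?Z' + zdim (?Z \<inter> ?B)"
    using zdim_sum_Int[of ?Z' "?Z \<inter> ?B"] P
    by (simp add: subspace_cycles1 subspace_boundaries1 finite_cycles1 chain_space.subspace_inter)
  then have "int (pers_rank1 P d r s) = int (pers_rank1 ?P d r s)"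
    using P by (simp add: pers_rank1_int)
  then show ?thesis by simp
qed

text \<open>For the pulled-back distance each point outside \<open>P'\<close> duplicates its image
  under \<open>g\<close>, so these points can be removed one at a time.\<close>

lemma pers_rank1_retract:
  assumes "finite P" "P' \<subseteq> P" "g ` P \<subseteq> P'" "\<And>x. x \<in> P' \<Longrightarrow> g x = x" "r \<le> s"
  shows "pers_rank1 P (\<lambda>x y. d (g x) (g y)) r s = pers_rank1 P' d r s"
  using assms(1-3)
proof (induction "card (P - P')" arbitrary: P)
  case 0
  then have "P = P'" by auto
  have eq: "vr_simplex P' (\<lambda>x y. d (g x) (g y)) u \<sigma> = vr_simplex P' d u \<sigma>" for u \<sigma>
    using assms(4) unfolding vr_simplex_def by (metis subsetD)
  then show ?case unfolding \<open>P = P'\<close> by (rule pers_rank1_cong) (rule eq)+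
next
  case (Suc n)
  then obtain x where x: "x \<in> P" "x \<notin> P'" by (metis card.empty Diff_iff equals0I nat.distinct(1))
  have gx: "g x \<in> P'" using Suc.prems x by blast
  have "pers_rank1 P (\<lambda>x y. d (g x) (g y)) r s = pers_rank1 (P - {x}) (\<lambda>x y. d (g x) (g y)) r s"
    using Suc.prems x gx assms(4,5)
    by (intro pers_rank1_remove_duplicate[where y = "g x"]) auto
  also have "\<dots> = pers_rank1 P' d r s"
  proof (rule Suc.hyps(1))
    have "P - {x} - P' = (P - P') - {x}" by blast
    then show "n = card (P - {x} - P')" using Suc.hyps(2) x by simp
  qed (use Suc.prems x in auto)
  finally show ?case .
qed

section \<open>Persistence diagrams are determined by quadrant counts\<close>

abbreviation crit_set :: "'p set \<Rightarrow> ('p \<Rightarrow> 'p \<Rightarrow> real) \<Rightarrow> real set" where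
  "crit_set P d \<equiv> {0} \<union> {d x y | x y. x \<in> P \<and> y \<in> P}"

lemma finite_crit_set: "finite P \<Longrightarrow> finite (crit_set P d)"
  using finite_image_set2[of "\<lambda>x. x \<in> P" "\<lambda>y. y \<in> P" d] by simp

lemma set_crit_vals: "finite P \<Longrightarrow> set (crit_vals P d) = crit_set P d"
  unfolding crit_vals_def by (rule set_sorted_list_of_set) (rule finite_crit_set)

lemma crit_vals_less:
  "i < j \<Longrightarrow> j < length (crit_vals P d) \<Longrightarrow> crit_vals P d ! i < crit_vals P d ! j"
  using strict_sorted_list_of_set[of "crit_set P d"] sorted_wrt_nth_less
  unfolding crit_vals_def by blast

lemma crit_vals_le:
  "i \<le> j \<Longrightarrow> j < length (crit_vals P d) \<Longrightarrow> crit_vals P d ! i \<le> crit_vals P d ! j"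
  using crit_vals_less[of i j P d] by (cases "i = j") auto

lemma vr_simplex_level_cong:
  assumes "\<And>x y. x \<in> P \<Longrightarrow> y \<in> P \<Longrightarrow> d x y \<le> r \<longleftrightarrow> d' x y \<le> r'"
  shows "vr_simplex P d r \<sigma> \<longleftrightarrow> vr_simplex P d' r' \<sigma>"
  using assms unfolding vr_simplex_def by blast

text \<open>Below all self-distances the complex has not even a vertex. This handles negative
  levels, which lie below every critical value of a nonnegative distance.\<close>

lemma pers_rank1_negative:
  fixes P :: "'p set"
  assumes "\<And>x. x \<in> P \<Longrightarrow> r < d x x"
  shows "pers_rank1 P d r s = 0"
proof -
  have "\<not> vr_simplex P d r \<sigma>" for \<sigma>
  proof
    assume \<sigma>: "vr_simplex P d r \<sigma>"
    then obtain x where "x \<in> \<sigma>" by (auto simp: vr_simplex_def)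
    then have "x \<in> P" "d x x \<le> r" using \<sigma> by (auto simp: vr_simplex_def)
    then show False using assms[of x] by simp
  qed
  then have "chains P d r 1 \<subseteq> {0}" by (auto simp: chains_def fun_eq_iff)
  then have "cycles1 P d r \<subseteq> {0}" unfolding cycles1_def by blast
  moreover have "0 \<in> cycles1 P d r" by (rule chain_space.subspace_0[OF subspace_cycles1])
  ultimately have "cycles1 P d r = {0}" by blast
  moreover have "zdim {0 :: 'p set \<Rightarrow> bit} = 0"
    using chain_space.dim_eq_card_independent[OF chain_space.independent_empty]
      chain_space.dim_span[of "{} :: ('p set \<Rightarrow> bit) set"]
    by (metis card.empty chain_space.span_empty zdim_eq_dim)
  ultimately show ?thesis by (simp add: pers_rank1_def)
qed

text \<open>Supermodularity of the ranks, or their monotonicity when \<open>i = 0\<close>. It makes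
  the conversion \<open>nat\<close> in \<open>dgm1\<close> lossless.\<close>

lemma dgm_mult1_nonneg:
  assumes P: "finite P" and ij: "i < j" "j < length (crit_vals P d)"
  shows "0 \<le> dgm_mult1 P d i j"
proof -
  let ?a = "crit_vals P d"
  have le: "?a ! (i - 1) \<le> ?a ! i" "?a ! (j - 1) \<le> ?a ! j"
    using ij by (auto intro: crit_vals_le)
  show ?thesis
  proof (cases "i = 0")
    case True
    then show ?thesis
      using pers_rank1_antimono[OF P le(2), of d "?a ! i"] by (simp add: dgm_mult1_def Let_def)
  next
    case False
    then show ?thesis
      using pers_rank1_supermodular[OF P le, of d] by (simp add: dgm_mult1_def Let_def)
  qed
qed

lemma size_filter_sum:
  "size (filter_mset Q (\<Sum>i\<in>I. f i)) = (\<Sum>i\<in>I. size (filter_mset Q (f i)))"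
  by (induction I rule: infinite_finite_induct) auto

text \<open>The number of diagram points alive from \<open>r\<close> through \<open>s\<close>, the
  counterpart of a persistent Betti number. These counts determine the off-diagonal points.\<close>

definition quadrant :: "(real \<times> real) multiset \<Rightarrow> real \<Rightarrow> real \<Rightarrow> nat" where
  "quadrant D r s = size {#p \<in># D. fst p \<le> r \<and> s < snd p#}"

text \<open>The sum telescopes in both directions and leaves the four corners of the rectangle. The
  first index is shifted so that \<open>B 0\<close> can represent the row of index -1.\<close>

lemma sum_telescope_rect:
  fixes B :: "nat \<Rightarrow> nat \<Rightarrow> int"
  assumes "q < n"
  shows "(\<Sum>i<m. \<Sum>j\<in>{q<..<n}. B (Suc i) (j - 1) - B (Suc i) j - B i (j - 1) + B i j)
    = B m q - B m (n - 1) - B 0 q + B 0 (n - 1)"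
proof -
  have tel: "(\<Sum>j\<in>{q<..<n}. G (j - 1) - G j) = G q - G (n - 1)" for G :: "nat \<Rightarrow> int"
    using assms
  proof (induction n)
    case (Suc n)
    show ?case
    proof (cases "q = n")
      case False
      then have "{q<..<Suc n} = insert n {q<..<n}" using Suc.prems by auto
      then show ?thesis using Suc False by simp
    next
      case True
      then have "{q<..<Suc n} = {}" by auto
      then show ?thesis using True by simp
    qed
  qed simp
  have "(\<Sum>i<m. \<Sum>j\<in>{q<..<n}. B (Suc i) (j - 1) - B (Suc i) j - B i (j - 1) + B i j)
    = (\<Sum>i<m. (B (Suc i) q - B (Suc i) (n - 1)) - (B i q - B i (n - 1)))"
  proof (rule sum.cong[OF refl])
    fix i
    show "(\<Sum>j\<in>{q<..<n}. B (Suc i) (j - 1) - B (Suc i) j - B i (j - 1) + B i j)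
      = (B (Suc i) q - B (Suc i) (n - 1)) - (B i q - B i (n - 1))"
      using tel[of "\<lambda>j. B (Suc i) j - B i j"] by (simp add: algebra_simps)
  qed
  also have "\<dots> = B m q - B m (n - 1) - B 0 q + B 0 (n - 1)"
    using sum_lessThan_telescope[of "\<lambda>i. B i q - B i (n - 1)" m] by simp
  finally show ?thesis .
qed

text \<open>The index is that of the largest critical value not above \<open>r\<close>; one exists
  because 0 is always critical.\<close>

lemma crit_vals_index:
  assumes P: "finite P" and "0 \<le> r"
  obtains p where "p < length (crit_vals P d)"
    "\<And>i. i < length (crit_vals P d) \<Longrightarrow> crit_vals P d ! i \<le> r \<longleftrightarrow> i \<le> p"
proof -
  let ?a = "crit_vals P d"
  let ?I = "{i. i < length ?a \<and> ?a ! i \<le> r}"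
  have "0 \<in> set ?a" by (simp add: set_crit_vals P)
  then have ne: "?I \<noteq> {}" using assms(2) by (auto simp: in_set_conv_nth)
  have fin: "finite ?I" by simp
  let ?p = "Max ?I"
  have p: "?p < length ?a" "?a ! ?p \<le> r" using Max_in[OF fin ne] by auto
  show ?thesis
  proof (rule that[of ?p])
    fix i assume i: "i < length ?a"
    show "?a ! i \<le> r \<longleftrightarrow> i \<le> ?p"
    proof
      assume "?a ! i \<le> r" then show "i \<le> ?p" using i fin by auto
    next
      assume "i \<le> ?p"
      then show "?a ! i \<le> r" using crit_vals_le[OF _ p(1)] p(2) order_trans by blast
    qed
  qed (rule p)
qed

lemma dgm1_elem:
  assumes "finite P" "p \<in># dgm1 P d"
  shows "fst p \<in> crit_set P d" "snd p \<in> crit_set P d" "fst p < snd p"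
proof -
  let ?a = "crit_vals P d"
  have "finite {(i, j). i < j \<and> j < length ?a}"
    by (rule finite_subset[of _ "{..<length ?a} \<times> {..<length ?a}"]) auto
  then obtain i j where ij: "i < j" "j < length ?a" "p = (?a ! i, ?a ! j)"
    using assms(2) unfolding dgm1_def Let_def
    by (auto simp: set_mset_sum split: if_splits)
  then have "fst p \<in> set ?a" "snd p \<in> set ?a" by auto
  then show "fst p \<in> crit_set P d" "snd p \<in> crit_set P d"
    by (simp_all only: set_crit_vals assms(1))
  show "fst p < snd p" using ij crit_vals_less by auto
qed

text \<open>Multiplicities summed over a rectangle of indices telescope to the ranks at its corners.
  The rank at \<open>R\<close> is the corner at the last critical value, where the sum over deaths
  ends.\<close>

lemma quadrant_dgm1:
  assumes P: "finite P" and d: "\<And>x y. x \<in> P \<Longrightarrow> y \<in> P \<Longrightarrow> 0 \<le> d x y \<and> d x y \<le> R"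
    and R: "0 \<le> R" and rs: "r \<le> s"
  shows "int (quadrant (dgm1 P d) r s) = int (pers_rank1 P d r s) - int (pers_rank1 P d r R)"
proof (cases "r < 0")
  case True
  have "\<not> fst p \<le> r" if "p \<in># dgm1 P d" for p
    using dgm1_elem(1)[OF P that] d True by fastforce
  then have "{#p \<in># dgm1 P d. fst p \<le> r \<and> s < snd p#} = {#}"
    by (simp add: filter_mset_cong[OF refl, of _ _ "\<lambda>_. False"])
  moreover have "pers_rank1 P d r u = 0" for u
    using d True by (intro pers_rank1_negative) force
  ultimately show ?thesis by (simp add: quadrant_def)
next
  case False
  let ?a = "crit_vals P d"
  let ?n = "length ?a"
  define B where "B i j = (if i = 0 then 0 else int (pers_rank1 P d (?a ! (i - 1)) (?a ! j)))" for i j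
  obtain p where p: "p < ?n" "\<And>i. i < ?n \<Longrightarrow> ?a ! i \<le> r \<longleftrightarrow> i \<le> p"
    using crit_vals_index[OF P, of r d] False by auto
  obtain q where q: "q < ?n" "\<And>i. i < ?n \<Longrightarrow> ?a ! i \<le> s \<longleftrightarrow> i \<le> q"
    using crit_vals_index[OF P, of s d] False rs by auto
  have pq: "p \<le> q" using p q rs by (meson order.trans order_refl)
  \<comment> \<open>The complex does not change between consecutive critical values, so each level
    may be replaced by the critical value below it.\<close>
  have level: "vr_simplex P d u \<sigma> \<longleftrightarrow> vr_simplex P d (?a ! k) \<sigma>"
    if k: "k < ?n" "\<And>i. i < ?n \<Longrightarrow> ?a ! i \<le> u \<longleftrightarrow> i \<le> k" for u k \<sigma>
  proof (rule vr_simplex_level_cong)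
    fix x y assume "x \<in> P" "y \<in> P"
    then have "d x y \<in> set ?a" by (auto simp: set_crit_vals P)
    then obtain i where i: "i < ?n" "d x y = ?a ! i" by (auto simp: in_set_conv_nth)
    show "d x y \<le> u \<longleftrightarrow> d x y \<le> ?a ! k"
      using k(2)[OF i(1)] i crit_vals_le[of i k P d] crit_vals_less[of k i P d] k(1) by force
  qed
  have R': "?a ! i \<le> R \<longleftrightarrow> i \<le> ?n - 1" if "i < ?n" for i
  proof -
    have "?a ! i \<in> crit_set P d"
      using nth_mem[OF that] by (simp only: set_crit_vals[OF P])
    then show ?thesis using d R that by auto
  qed
  have n: "?n - 1 < ?n" using p by simp
  have "int (quadrant (dgm1 P d) r s) =
    (\<Sum>(i, j)\<in>{(i, j). i < j \<and> j < ?n}. if i \<le> p \<and> q < j then dgm_mult1 P d i j else 0)"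
    unfolding quadrant_def dgm1_def Let_def size_filter_sum of_nat_sum
  proof (intro sum.cong refl, clarify)
    fix i j assume ij: "i < j" "j < ?n"
    have "filter_mset Q (replicate_mset k z) = (if Q z then replicate_mset k z else {#})"
      for Q k and z :: "real \<times> real" by (induction k) auto
    then show "int (size {#p \<in># replicate_mset (nat (dgm_mult1 P d i j)) (?a ! i, ?a ! j). fst p \<le> r \<and> s < snd p#})
      = (if i \<le> p \<and> q < j then dgm_mult1 P d i j else 0)"
      using ij p(2)[of i] q(2)[of j] dgm_mult1_nonneg[OF P ij] by auto
  qed
  \<comment> \<open>On this rectangle \<open>i < j\<close> is automatic, since
    \<open>i \<le> p \<le> q < j\<close>.\<close>
  also have "\<dots> = (\<Sum>(i, j)\<in>{..<Suc p} \<times> {q<..<?n}. dgm_mult1 P d i j)"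
  proof (rule sum.mono_neutral_cong_right)
    show "finite {(i, j). i < j \<and> j < ?n}"
      by (rule finite_subset[of _ "{..<?n} \<times> {..<?n}"]) auto
  qed (use pq in \<open>auto split: if_splits\<close>)
  also have "\<dots> = (\<Sum>i<Suc p. \<Sum>j\<in>{q<..<?n}. dgm_mult1 P d i j)"
    by (simp only: sum.cartesian_product)
  also have "\<dots> = (\<Sum>i<Suc p. \<Sum>j\<in>{q<..<?n}. B (Suc i) (j - 1) - B (Suc i) j - B i (j - 1) + B i j)"
    by (intro sum.cong refl) (simp add: dgm_mult1_def Let_def B_def)
  also have "\<dots> = B (Suc p) q - B (Suc p) (?n - 1)"
    unfolding sum_telescope_rect[OF q(1)] by (simp add: B_def)
  also have "B (Suc p) q = int (pers_rank1 P d r s)"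
    using pers_rank1_cong[OF level[OF p] level[OF q]] by (simp add: B_def)
  also have "B (Suc p) (?n - 1) = int (pers_rank1 P d r R)"
    using pers_rank1_cong[OF level[OF p] level[OF n R']] by (simp add: B_def)
  finally show ?thesis .
qed

text \<open>Inclusion-exclusion over four quadrants isolates the multiplicity of a point
  \<open>(u, v)\<close>. Since \<open>u < v\<close>, the four corners can be chosen with
  \<open>r \<le> s\<close>.\<close>

lemma multiset_eqI_quadrant:
  assumes D: "\<And>p. p \<in># D \<Longrightarrow> fst p < snd p" and E: "\<And>p. p \<in># E \<Longrightarrow> fst p < snd p"
    and eq: "\<And>r s. r \<le> s \<Longrightarrow> quadrant D r s = quadrant E r s"
  shows "D = E"
proof (rule multiset_eqI)
  fix p :: "real \<times> real"
  obtain u v where p: "p = (u, v)" by (cases p)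
  define F where "F = fst ` set_mset (D + E) \<union> snd ` set_mset (D + E)"
  have fin: "finite F" by (simp add: F_def)
  show "count D p = count E p"
  proof (cases "u < v")
    case False
    then have "p \<notin># D" "p \<notin># E" using D E p by fastforce+
    then show ?thesis by (simp add: not_in_iff)
  next
    case True
    \<comment> \<open>No coordinate of \<open>F\<close> lies strictly between \<open>w\<close> and
      \<open>v\<close>, or strictly between \<open>u'\<close> and \<open>u\<close>. The inserted
      values keep the maxima defined, and \<open>u\<close> also ensures
      \<open>u \<le> w\<close>.\<close>
    define w where "w = Max (insert u {x \<in> F. x < v})"
    define u' where "u' = Max (insert (u - 1) {x \<in> F. x < u})"
    have w: "u \<le> w" "w < v" "\<And>x. x \<in> F \<Longrightarrow> w < x \<longleftrightarrow> v \<le> x"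
    proof -
      show "u \<le> w" "w < v" using True fin by (auto simp: w_def)
      fix x assume "x \<in> F"
      then show "w < x \<longleftrightarrow> v \<le> x" using \<open>w < v\<close> fin by (auto simp: w_def not_le)
    qed
    have u': "u' < u" "\<And>x. x \<in> F \<Longrightarrow> x \<le> u' \<longleftrightarrow> x < u"
    proof -
      show "u' < u" using fin by (auto simp: u'_def)
      fix x assume "x \<in> F"
      then show "x \<le> u' \<longleftrightarrow> x < u" using \<open>u' < u\<close> fin by (auto simp: u'_def Max_ge_iff)
    qed
    have count: "int (count C p) = int (quadrant C u w) - int (quadrant C u v)
        - int (quadrant C u' w) + int (quadrant C u' v)"
      if "\<And>z. z \<in># C \<Longrightarrow> fst z \<in> F \<and> snd z \<in> F" for C
      using that
    proof (induction C)
      case (add z C)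
      then have z: "w < snd z \<longleftrightarrow> v \<le> snd z" "fst z \<le> u' \<longleftrightarrow> fst z < u" using w u' by auto
      have "int (count C p) = int (quadrant C u w) - int (quadrant C u v)
        - int (quadrant C u' w) + int (quadrant C u' v)" using add by simp
      then show ?case
        by (cases z) (use z in \<open>auto simp: quadrant_def p\<close>)
    qed (simp add: quadrant_def)
    have "int (count D p) = int (count E p)"
      using count[of D] count[of E] eq w u' True by (simp add: F_def)
    then show ?thesis by simp
  qed
qed

text \<open>Each complex of \<open>d\<close> at a nonnegative level is a complex of
  \<open>h\<close>, so the quadrant counts on both sides reduce to the same ranks. Points whose
  coordinates are merged by \<open>\<phi>\<close> land on the diagonal and disappear.\<close>

lemma dgm1_coarsen:
  assumes P: "finite P" and h: "\<And>x y. x \<in> P \<Longrightarrow> y \<in> P \<Longrightarrow> 0 \<le> h x y"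
    and \<phi>: "mono_on (crit_set P h) \<phi>" "\<phi> 0 = 0"
    and d: "\<And>x y. x \<in> P \<Longrightarrow> y \<in> P \<Longrightarrow> d x y = \<phi> (h x y)"
  shows "dgm1 P d = {#p \<in># image_mset (map_prod \<phi> \<phi>) (dgm1 P h). fst p < snd p#}"
proof (rule multiset_eqI_quadrant)
  let ?A = "crit_set P h"
  have fin: "finite ?A" by (rule finite_crit_set[OF P])
  have d0: "0 \<le> d x y" if "x \<in> P" "y \<in> P" for x y
    using mono_onD[OF \<phi>(1), of 0 "h x y"] h[OF that] \<phi>(2) d[OF that] that by auto
  fix r s :: real assume rs: "r \<le> s"
  let ?R = "Max ?A"
  have R: "x \<le> ?R" if "x \<in> ?A" for x using fin that by (rule Max_ge)
  have hR: "h x y \<le> ?R" if "x \<in> P" "y \<in> P" for x y using R that by blast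
  have RA: "?R \<in> ?A" by (rule Max_in[OF fin]) simp
  have Rd: "d x y \<le> \<phi> ?R" if "x \<in> P" "y \<in> P" for x y
    using mono_onD[OF \<phi>(1) _ RA R, of "h x y"] d that by auto
  have R0: "0 \<le> ?R" by (rule R) simp
  have \<phi>R0: "0 \<le> \<phi> ?R" using mono_onD[OF \<phi>(1) _ RA R0] \<phi>(2) by simp
  have L: "int (quadrant (dgm1 P d) r s) = int (pers_rank1 P d r s) - int (pers_rank1 P d r (\<phi> ?R))"
    by (rule quadrant_dgm1[OF P _ \<phi>R0 rs]) (use d0 Rd in auto)
  have Q: "quadrant {#p \<in># image_mset (map_prod \<phi> \<phi>) (dgm1 P h). fst p < snd p#} r s
    = size {#p \<in># dgm1 P h. \<phi> (fst p) \<le> r \<and> s < \<phi> (snd p)#}"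
  proof -
    \<comment> \<open>A counted point is born by \<open>r \<le> s\<close> and dies after
      \<open>s\<close>, so it is off the diagonal anyway.\<close>
    have "filter_mset (\<lambda>p. \<phi> (fst p) < \<phi> (snd p) \<and> \<phi> (fst p) \<le> r \<and> s < \<phi> (snd p)) (dgm1 P h)
      = {#p \<in># dgm1 P h. \<phi> (fst p) \<le> r \<and> s < \<phi> (snd p)#}"
      using rs by (intro filter_mset_cong) auto
    then show ?thesis
      by (simp add: quadrant_def filter_filter_mset filter_mset_image_mset conj_commute)
  qed
  show "quadrant (dgm1 P d) r s
    = quadrant {#p \<in># image_mset (map_prod \<phi> \<phi>) (dgm1 P h). fst p < snd p#} r s"
  proof (cases "r < 0")
    case True
    have "\<not> \<phi> (fst p) \<le> r" if "p \<in># dgm1 P h" for p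
    proof -
      have "fst p \<in> ?A" using dgm1_elem[OF P that] by simp
      moreover from this have "0 \<le> fst p" using h by auto
      ultimately have "0 \<le> \<phi> (fst p)" using mono_onD[OF \<phi>(1), of 0] \<phi>(2) by auto
      then show ?thesis using True by simp
    qed
    then have "{#p \<in># dgm1 P h. \<phi> (fst p) \<le> r \<and> s < \<phi> (snd p)#} = {#}"
      by (simp add: filter_mset_cong[OF refl, of _ _ "\<lambda>_. False"])
    moreover have "pers_rank1 P d r u = 0" for u
      using d0 True by (intro pers_rank1_negative) force
    ultimately show ?thesis using L Q by simp
  next
    case False
    \<comment> \<open>\<open>lev u\<close> is the largest critical value that \<open>\<phi>\<close>
      sends to at most \<open>u\<close>, an upper adjoint of \<open>\<phi>\<close> on critical
      values. For \<open>u \<ge> 0\<close> it exists because \<open>\<phi>\<close> fixes 0.\<close>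
    define lev where "lev u = Max {a \<in> ?A. \<phi> a \<le> u}" for u
    have lev: "a \<le> lev u \<longleftrightarrow> \<phi> a \<le> u" if "0 \<le> u" "a \<in> ?A" for u a
    proof -
      have ne: "{a \<in> ?A. \<phi> a \<le> u} \<noteq> {}" using that \<phi>(2) by auto
      have fin': "finite {a \<in> ?A. \<phi> a \<le> u}" using fin by simp
      have m: "lev u \<in> ?A" "\<phi> (lev u) \<le> u"
        using Max_in[OF fin' ne] by (auto simp: lev_def)
      show ?thesis
      proof
        assume "a \<le> lev u"
        then show "\<phi> a \<le> u" using mono_onD[OF \<phi>(1) that(2) m(1)] m(2) by simp
      next
        assume "\<phi> a \<le> u"
        then show "a \<le> lev u" unfolding lev_def using fin' that by (intro Max_ge) auto
      qed
    qed
    have vr: "vr_simplex P d u \<sigma> \<longleftrightarrow> vr_simplex P h (lev u) \<sigma>" if "0 \<le> u" for u \<sigma>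
    proof (rule vr_simplex_level_cong)
      fix x y assume xy: "x \<in> P" "y \<in> P"
      then have "h x y \<in> ?A" by blast
      then show "d x y \<le> u \<longleftrightarrow> h x y \<le> lev u" using lev[OF that] d xy by simp
    qed
    have vrR: "vr_simplex P d (\<phi> ?R) \<sigma> \<longleftrightarrow> vr_simplex P h ?R \<sigma>" for \<sigma>
    proof (rule vr_simplex_level_cong)
      fix x y assume xy: "x \<in> P" "y \<in> P"
      then have "h x y \<in> ?A" by blast
      then show "d x y \<le> \<phi> ?R \<longleftrightarrow> h x y \<le> ?R" using Rd[OF xy] R by simp
    qed
    have r0: "0 \<le> r" and s0: "0 \<le> s" using False rs by auto
    have lrs: "lev r \<le> lev s"
    proof -
      have "lev r \<in> {a \<in> ?A. \<phi> a \<le> r}"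
        unfolding lev_def using fin r0 \<phi>(2) by (intro Max_in) auto
      then have "\<phi> (lev r) \<le> s" "lev r \<in> ?A" using rs by auto
      then show ?thesis using lev[OF s0] by simp
    qed
    have "{#p \<in># dgm1 P h. \<phi> (fst p) \<le> r \<and> s < \<phi> (snd p)#}
      = {#p \<in># dgm1 P h. fst p \<le> lev r \<and> lev s < snd p#}"
    proof (rule filter_mset_cong[OF refl])
      fix p assume "p \<in># dgm1 P h"
      then have "fst p \<in> ?A" "snd p \<in> ?A" using dgm1_elem[OF P] by blast+
      then show "(\<phi> (fst p) \<le> r \<and> s < \<phi> (snd p)) = (fst p \<le> lev r \<and> lev s < snd p)"
        using lev[OF r0] lev[OF s0] by (simp add: not_le[symmetric])
    qed
    then have "quadrant {#p \<in># image_mset (map_prod \<phi> \<phi>) (dgm1 P h). fst p < snd p#} r s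
      = quadrant (dgm1 P h) (lev r) (lev s)"
      unfolding Q by (simp add: quadrant_def)
    moreover have "int (quadrant (dgm1 P h) (lev r) (lev s))
      = int (pers_rank1 P h (lev r) (lev s)) - int (pers_rank1 P h (lev r) ?R)"
      by (rule quadrant_dgm1[OF P _ R0 lrs]) (use h hR in auto)
    ultimately show ?thesis
      using L pers_rank1_cong[OF vr[OF r0] vr[OF s0]] pers_rank1_cong[OF vr[OF r0] vrR] by simp
  qed
qed (use dgm1_elem[OF P] in auto)

text \<open>As \<open>g\<close> maps \<open>P\<close> onto \<open>P'\<close>, both sides have the
  same critical values; the ranks agree because duplicates do not affect them.\<close>

lemma dgm1_retract:
  assumes P: "finite P" "P' \<subseteq> P" "g ` P \<subseteq> P'" "\<And>x. x \<in> P' \<Longrightarrow> g x = x"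
  shows "dgm1 P (\<lambda>x y. d (g x) (g y)) = dgm1 P' d"
proof -
  let ?d = "\<lambda>x y. d (g x) (g y)"
  have "crit_set P ?d = crit_set P' d"
  proof -
    have "g ` P = P'" using P by force
    then show ?thesis by blast
  qed
  then have a: "crit_vals P ?d = crit_vals P' d" by (simp only: crit_vals_def)
  have "dgm_mult1 P ?d i j = dgm_mult1 P' d i j" if "i < j" "j < length (crit_vals P' d)" for i j
  proof -
    \<comment> \<open>Ordered index pairs suffice: for \<open>i < j\<close> every rank in the
      multiplicity formula has first index at most the second, as
      \<open>i \<le> j - 1\<close>.\<close>
    have eq: "pers_rank1 P ?d (crit_vals P' d ! k) (crit_vals P' d ! l)
      = pers_rank1 P' d (crit_vals P' d ! k) (crit_vals P' d ! l)" if "k \<le> l" "l \<le> j" for k l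
      using that \<open>j < _\<close> by (intro pers_rank1_retract P crit_vals_le) auto
    show ?thesis using that by (simp add: dgm_mult1_def a eq Let_def)
  qed
  then show ?thesis unfolding dgm1_def a Let_def by (intro sum.cong) auto
qed

section \<open>Stability under perturbation of the distance function\<close>

text \<open>A bottleneck matching in symmetric form: both diagrams are padded with diagonal points
  and then matched completely, which makes matchings easy to compose.\<close>

definition diagram_close :: "real \<Rightarrow> (real \<times> real) multiset \<Rightarrow> (real \<times> real) multiset \<Rightarrow> bool" where
  "diagram_close c D D' \<longleftrightarrow> (\<exists>A B. (\<forall>p\<in>#A + B. fst p = snd p) \<and>
     rel_mset (\<lambda>x y. linf x y \<le> c) (D + A) (D' + B))"

lemma rel_mset_union:
  assumes "rel_mset R A B" "rel_mset R C D"
  shows "rel_mset R (A + C) (B + D)"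
  using assms unfolding rel_mset_def by (metis list_all2_appendI mset_append)

lemma linf_refl [simp]: "linf x x = 0"
  by (simp add: linf_def)

lemma linf_triangle: "linf x z \<le> linf x y + linf y z"
  by (auto simp: linf_def max_def)

lemma rel_mset_linf_refl: "0 \<le> c \<Longrightarrow> rel_mset (\<lambda>x y. linf x y \<le> c) A A"
  by (rule multiset.rel_refl) simp

text \<open>Each matching is extended by the identity on padding of the other, so that both pass
  through \<open>D' + (A' + B)\<close>.\<close>

lemma diagram_close_trans:
  assumes "0 \<le> c" "0 \<le> c'" "diagram_close c D D'" "diagram_close c' D' D''"
  shows "diagram_close (c + c') D D''"
proof -
  obtain A B where 1: "\<forall>p\<in>#A + B. fst p = snd p" "rel_mset (\<lambda>x y. linf x y \<le> c) (D + A) (D' + B)"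
    using assms(3) unfolding diagram_close_def by blast
  obtain A' B' where 2: "\<forall>p\<in>#A' + B'. fst p = snd p"
    "rel_mset (\<lambda>x y. linf x y \<le> c') (D' + A') (D'' + B')"
    using assms(4) unfolding diagram_close_def by blast
  have "rel_mset (\<lambda>x y. linf x y \<le> c) (D + (A + A')) (D' + (A' + B))"
    using rel_mset_union[OF 1(2) rel_mset_linf_refl[OF assms(1), of A']] by (simp add: ac_simps)
  moreover have "rel_mset (\<lambda>x y. linf x y \<le> c') (D' + (A' + B)) (D'' + (B' + B))"
    using rel_mset_union[OF 2(2) rel_mset_linf_refl[OF assms(2), of B]] by (simp add: ac_simps)
  ultimately have "rel_mset ((\<lambda>x y. linf x y \<le> c) OO (\<lambda>x y. linf x y \<le> c'))
      (D + (A + A')) (D'' + (B' + B))"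
    unfolding multiset.rel_compp by blast
  then have "rel_mset (\<lambda>x y. linf x y \<le> c + c') (D + (A + A')) (D'' + (B' + B))"
  proof (rule multiset.rel_mono_strong)
    fix x z assume "((\<lambda>x y. linf x y \<le> c) OO (\<lambda>x y. linf x y \<le> c')) x z"
    then obtain y where "linf x y \<le> c" "linf y z \<le> c'" by auto
    then show "linf x z \<le> c + c'" using linf_triangle[of x z y] by linarith
  qed
  moreover have "\<forall>p\<in>#(A + A') + (B' + B). fst p = snd p" using 1(1) 2(1) by auto
  ultimately show ?thesis unfolding diagram_close_def by blast
qed

text \<open>The two images of the same point are matched; images that fall on the diagonal serve as
  the padding.\<close>

lemma diagram_close_image:
  assumes "\<And>p. p \<in># C \<Longrightarrow> fst (f p) \<le> snd (f p)" "\<And>p. p \<in># C \<Longrightarrow> fst (g p) \<le> snd (g p)"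
    and c: "\<And>p. p \<in># C \<Longrightarrow> linf (f p) (g p) \<le> c"
  shows "diagram_close c {#p \<in># image_mset f C. fst p < snd p#} {#p \<in># image_mset g C. fst p < snd p#}"
proof -
  let ?off = "\<lambda>p :: real \<times> real. fst p < snd p"
  let ?A = "{#p \<in># image_mset f C. \<not> ?off p#}" and ?B = "{#p \<in># image_mset g C. \<not> ?off p#}"
  have "rel_mset (\<lambda>x y. linf x y \<le> c) (image_mset f C) (image_mset g C)"
    unfolding multiset.rel_map by (rule multiset.rel_refl_strong) (rule c)
  then have "rel_mset (\<lambda>x y. linf x y \<le> c) (filter_mset ?off (image_mset f C) + ?A)
      (filter_mset ?off (image_mset g C) + ?B)"
    by (simp flip: multiset_partition)
  moreover have "\<forall>p\<in>#?A + ?B. fst p = snd p"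
  proof
    fix p assume "p \<in># ?A + ?B"
    then obtain q where "q \<in># C" "p = f q \<or> p = g q" "\<not> fst p < snd p" by auto
    then show "fst p = snd p" using assms(1,2)[of q] by auto
  qed
  ultimately show ?thesis unfolding diagram_close_def by blast
qed

text \<open>Both distances are monotone functions of \<open>f + g\<close>, so both diagrams are
  images of one diagram, under maps at distance at most \<open>c\<close> on its critical
  values.\<close>

lemma diagram_close_no_inversion:
  fixes f g :: "'p \<Rightarrow> 'p \<Rightarrow> real"
  assumes P: "finite P" and c: "0 \<le> c"
    and fg: "\<And>x y. x \<in> P \<Longrightarrow> y \<in> P \<Longrightarrow> 0 \<le> f x y \<and> 0 \<le> g x y \<and> \<bar>f x y - g x y\<bar> \<le> c"
    and inv: "\<And>x y x' y'. x \<in> P \<Longrightarrow> y \<in> P \<Longrightarrow> x' \<in> P \<Longrightarrow> y' \<in> P \<Longrightarrow>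
      f x y < f x' y' \<Longrightarrow> g x y \<le> g x' y'"
  shows "diagram_close c (dgm1 P f) (dgm1 P g)"
proof -
  define h where "h x y = f x y + g x y" for x y
  \<comment> \<open>If one function dropped strictly, the other could not rise strictly, and the sum
    would drop.\<close>
  have hle: "f x y \<le> f x' y' \<and> g x y \<le> g x' y'"
    if "x \<in> P" "y \<in> P" "x' \<in> P" "y' \<in> P" "h x y \<le> h x' y'" for x y x' y'
    using inv[of x' y' x y] inv[of x y x' y'] that by (fastforce simp: h_def)
  \<comment> \<open>\<open>env k\<close> is the monotone \<open>\<phi>\<close> with \<open>k = \<phi> \<circ> h\<close> on \<open>P\<close>\<close>
  define env where "env k t = Max (insert 0 {k x y | x y. x \<in> P \<and> y \<in> P \<and> h x y \<le> t})"
    for k :: "'p \<Rightarrow> 'p \<Rightarrow> real" and t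
  have fin: "finite {k x y | x y. x \<in> P \<and> y \<in> P \<and> h x y \<le> t}" for k :: "'p \<Rightarrow> 'p \<Rightarrow> real" and t
    by (rule finite_subset[OF _ finite_crit_set[OF P, of k]]) auto
  have mono: "env k t \<le> env k u" if "t \<le> u" for k t u
    unfolding env_def using fin order_trans[OF _ that]
    by (intro Max_mono insert_mono) blast+
  have env: "env k (h x y) = k x y" if "x \<in> P" "y \<in> P" "k = f \<or> k = g" for k x y
    unfolding env_def using fin that fg hle by (intro Max_eqI) auto
  \<comment> \<open>By nonnegativity, \<open>h x y \<le> 0\<close> forces both distances to vanish;
    the inserted 0 covers the case of no such pair.\<close>
  have env0: "env k 0 = 0" if "k = f \<or> k = g" for k
  proof -
    have "k x y = 0" if "x \<in> P" "y \<in> P" "h x y \<le> 0" for x y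
      using fg[OF that(1,2)] that(3) \<open>k = f \<or> k = g\<close> by (auto simp: h_def)
    then show ?thesis unfolding env_def using fin by (intro Max_eqI) auto
  qed
  have dgm: "dgm1 P k = {#p \<in># image_mset (map_prod (env k) (env k)) (dgm1 P h). fst p < snd p#}"
    if "k = f \<or> k = g" for k
    by (rule dgm1_coarsen[OF P]) (use fg mono env env0 that in \<open>auto simp: h_def mono_on_def\<close>)
  have diff: "\<bar>env f t - env g t\<bar> \<le> c" if "t \<in> crit_set P h" for t
    using that fg env env0 c by auto
  show ?thesis
    unfolding dgm[of f, simplified] dgm[of g, simplified]
  proof (rule diagram_close_image)
    fix p assume "p \<in># dgm1 P h"
    note p = dgm1_elem[OF P this]
    show "fst (map_prod (env f) (env f) p) \<le> snd (map_prod (env f) (env f) p)"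
      "fst (map_prod (env g) (env g) p) \<le> snd (map_prod (env g) (env g) p)"
      using p(3) by (simp_all add: mono)
    show "linf (map_prod (env f) (env f) p) (map_prod (env g) (env g) p) \<le> c"
      using diff[OF p(1)] diff[OF p(2)] by (simp add: linf_def)
  qed
qed

text \<open>The straight line from \<open>f\<close> to \<open>g\<close> is cut at its first crossing: up to there no two values are
  strictly inverted, and after it strictly fewer pairs are.\<close>

lemma diagram_close_dgm1:
  fixes f g :: "'p \<Rightarrow> 'p \<Rightarrow> real"
  assumes P: "finite P" and c: "0 \<le> c"
    and fg: "\<And>x y. x \<in> P \<Longrightarrow> y \<in> P \<Longrightarrow> 0 \<le> f x y \<and> 0 \<le> g x y \<and> \<bar>f x y - g x y\<bar> \<le> c"
  shows "diagram_close c (dgm1 P f) (dgm1 P g)"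
proof -
  \<comment> \<open>The strict inversions of \<open>f\<close> against the fixed \<open>g\<close>;
    the induction is on their number, with \<open>f\<close> and \<open>c\<close> varying.\<close>
  define I where "I f = {(p, q) \<in> (P \<times> P) \<times> (P \<times> P).
    case_prod f p < case_prod f q \<and> case_prod g q < case_prod g p}" for f :: "'p \<Rightarrow> 'p \<Rightarrow> real"
  have finI: "finite (I f)" for f
    unfolding I_def by (rule finite_subset[of _ "(P \<times> P) \<times> (P \<times> P)"]) (use P in auto)
  show ?thesis using c fg
  proof (induction "card (I f)" arbitrary: f c rule: less_induct)
    case less
    show ?case
    proof (cases "I f = {}")
      case True
      then show ?thesis
        by (intro diagram_close_no_inversion[OF P less.prems(1)] less.prems(2))
           (auto simp: I_def not_less[symmetric])
    next
      case False
      let ?F = "case_prod f" and ?G = "case_prod g"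
      \<comment> \<open>The time at which the values at \<open>p\<close> and \<open>q\<close> meet
        on the straight line from \<open>f\<close> to \<open>g\<close>.\<close>
      define l where "l = (\<lambda>(p, q). (?F q - ?F p) / ((?F q - ?F p) + (?G p - ?G q)))"
      obtain p0 q0 where pq0: "arg_min_on l (I f) = (p0, q0)" by (rule prod.exhaust)
      have 0: "(p0, q0) \<in> I f" "\<And>p q. (p, q) \<in> I f \<Longrightarrow> l (p0, q0) \<le> l (p, q)"
        using arg_min_if_finite(1)[OF finI False, of l] arg_min_least[OF finI False, of _ l]
        by (auto simp: pq0)
      define L where "L = l (p0, q0)"
      have pos: "0 < ?F q - ?F p" "0 < ?G p - ?G q" if "(p, q) \<in> I f" for p q
        using that by (auto simp: I_def)
      have L01: "0 < L" "L < 1" using pos[OF 0(1)] by (simp_all add: L_def l_def field_simps)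
      define m where "m x y = (1 - L) * f x y + L * g x y" for x y
      let ?M = "case_prod m"
      have M: "?M p = (1 - L) * ?F p + L * ?G p" for p by (cases p) (simp add: m_def)
      have L0: "?M p0 = ?M q0"
        using pos[OF 0(1)] unfolding M L_def l_def by (simp add: field_simps)
      have Lmin: "L * ((?F q - ?F p) + (?G p - ?G q)) \<le> ?F q - ?F p" if "(p, q) \<in> I f" for p q
        using 0(2)[OF that] pos[OF that] unfolding L_def[symmetric]
        by (simp add: l_def pos_le_divide_eq)
      have "diagram_close (L * c) (dgm1 P f) (dgm1 P m)"
      proof (rule diagram_close_no_inversion[OF P])
        show "0 \<le> L * c" using L01 less.prems by simp
        fix x y assume xy: "x \<in> P" "y \<in> P"
        have "f x y - m x y = L * (f x y - g x y)" by (simp add: m_def algebra_simps)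
        then show "0 \<le> f x y \<and> 0 \<le> m x y \<and> \<bar>f x y - m x y\<bar> \<le> L * c"
          using less.prems(2)[OF xy] L01 by (auto simp: m_def abs_mult)
        fix x' y' assume xy': "x' \<in> P" "y' \<in> P" and lt: "f x y < f x' y'"
        show "m x y \<le> m x' y'"
        \<comment> \<open>An inverted pair has not yet crossed strictly at time \<open>L\<close>;
          any other pair is weakly ordered alike by \<open>f\<close> and \<open>g\<close>, hence by
          \<open>m\<close>.\<close>
        proof (cases "((x, y), (x', y')) \<in> I f")
          case True
          from Lmin[OF this] show ?thesis by (simp add: m_def algebra_simps)
        next
          case False
          then have "g x y \<le> g x' y'" using xy xy' lt by (auto simp: I_def)
          then show ?thesis unfolding m_def using lt L01
            by (intro add_mono mult_left_mono) auto
        qed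
      qed
      moreover have "diagram_close ((1 - L) * c) (dgm1 P m) (dgm1 P g)"
      proof (rule less.hyps)
        have "I m \<subseteq> I f"
        proof clarify
          fix x y x' y' assume pq: "((x, y), (x', y')) \<in> I m"
          then have lt: "m x y < m x' y'" "g x' y' < g x y" by (auto simp: I_def)
          have "f x y < f x' y'"
          proof (rule ccontr)
            assume "\<not> f x y < f x' y'"
            then have "m x' y' \<le> m x y" unfolding m_def using lt L01
              by (intro add_mono mult_left_mono) auto
            then show False using lt by simp
          qed
          then show "((x, y), (x', y')) \<in> I f" using pq by (auto simp: I_def)
        qed
        \<comment> \<open>The pair that crosses first is tied in \<open>m\<close>, so the set of
          inversions shrinks strictly.\<close>
        moreover have "(p0, q0) \<notin> I m" using L0 by (auto simp: I_def)
        ultimately show "card (I m) < card (I f)"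
          using 0(1) finI by (intro psubset_card_mono) auto
        show "0 \<le> (1 - L) * c" using L01 less.prems by simp
        fix x y assume xy: "x \<in> P" "y \<in> P"
        have "m x y - g x y = (1 - L) * (f x y - g x y)" by (simp add: m_def algebra_simps)
        then show "0 \<le> m x y \<and> 0 \<le> g x y \<and> \<bar>m x y - g x y\<bar> \<le> (1 - L) * c"
          using less.prems(2)[OF xy] L01 by (auto simp: m_def abs_mult)
      qed
      \<comment> \<open>The costs are proportional to the lengths of the pieces, so cutting the line
        does not increase their total \<open>c\<close>.\<close>
      ultimately have "diagram_close (L * c + (1 - L) * c) (dgm1 P f) (dgm1 P g)"
        using L01 less.prems by (intro diagram_close_trans) auto
      then show ?thesis by (simp add: algebra_simps)
    qed
  qed
qed

section \<open>Bottleneck distance and maximum persistence of close diagrams\<close>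

lemma diagram_close_pairs:
  assumes "diagram_close c D D'" and D: "\<And>p. p \<in># D \<Longrightarrow> fst p < snd p" "\<And>p. p \<in># D' \<Longrightarrow> fst p < snd p"
  shows "\<exists>Z. (\<forall>x y. (x, y) \<in># Z \<longrightarrow> linf x y \<le> c) \<and>
    D = {#p \<in># image_mset fst Z. fst p \<noteq> snd p#} \<and> D' = {#p \<in># image_mset snd Z. fst p \<noteq> snd p#}"
proof -
  obtain A B where AB: "\<forall>p\<in>#A + B. fst p = snd p" "rel_mset (\<lambda>x y. linf x y \<le> c) (D + A) (D' + B)"
    using assms(1) unfolding diagram_close_def by blast
  then obtain Z where Z: "set_mset Z \<subseteq> {(x, y). linf x y \<le> c}" "image_mset fst Z = D + A"
      "image_mset snd Z = D' + B"
    unfolding multiset.in_rel by blast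
  \<comment> \<open>The diagrams lie strictly above the diagonal, so removing diagonal points
    removes exactly the padding.\<close>
  have off: "{#p \<in># E + C. fst p \<noteq> snd p#} = E"
    if "\<And>p. p \<in># E \<Longrightarrow> fst p < snd p" "\<And>p. p \<in># C \<Longrightarrow> fst p = snd p"
    for E C :: "(real \<times> real) multiset"
  proof -
    have "{#p \<in># E. fst p \<noteq> snd p#} = {#p \<in># E. True#}"
      using that(1)[THEN less_imp_neq] by (intro filter_mset_cong) simp_all
    moreover have "{#p \<in># C. fst p \<noteq> snd p#} = {#}" using that(2) by simp
    ultimately show ?thesis by simp
  qed
  have "\<forall>x y. (x, y) \<in># Z \<longrightarrow> linf x y \<le> c" using Z(1) by auto
  moreover have "D = {#p \<in># D + A. fst p \<noteq> snd p#}" "D' = {#p \<in># D' + B. fst p \<noteq> snd p#}"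
    by (rule off[symmetric]; use AB(1) D in simp)+
  ultimately show ?thesis unfolding Z(2,3)[symmetric] by blast
qed

text \<open>Pairs with both points off the diagonal form the partial matching. A pair with just one
  such point leaves it unmatched, at a cost no larger than that of the pair.\<close>

lemma bottleneck_dist_le:
  assumes close: "diagram_close c D D'" and c: "0 \<le> c"
    and D: "\<And>p. p \<in># D \<Longrightarrow> fst p < snd p" "\<And>p. p \<in># D' \<Longrightarrow> fst p < snd p"
  shows "bottleneck_dist D D' \<le> c"
proof -
  let ?off = "\<lambda>p :: real \<times> real. fst p \<noteq> snd p"
  obtain Z where Z: "\<And>x y. (x, y) \<in># Z \<Longrightarrow> linf x y \<le> c"
    "D = filter_mset ?off (image_mset fst Z)" "D' = filter_mset ?off (image_mset snd Z)"
    using diagram_close_pairs[OF close D] by blast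
  define Mt where "Mt = {#z \<in># Z. ?off (fst z) \<and> ?off (snd z)#}"
  define U where "U = {#z \<in># Z. ?off (fst z) \<and> \<not> ?off (snd z)#}"
  define V where "V = {#z \<in># Z. ?off (snd z) \<and> \<not> ?off (fst z)#}"
  have "{#z \<in># Z. ?off (fst z)#} = Mt + U"
    unfolding Mt_def U_def filter_filter_mset[symmetric] by (induction Z) auto
  then have DU: "D = image_mset fst Mt + image_mset fst U"
    by (simp add: Z(2) filter_mset_image_mset)
  have "{#z \<in># Z. ?off (snd z)#} = Mt + V"
    unfolding Mt_def V_def by (induction Z) auto
  then have DV: "D' = image_mset snd Mt + image_mset snd V"
    by (simp add: Z(3) filter_mset_image_mset)
  have diag: "diag_dist x \<le> linf x y \<and> diag_dist x \<le> linf y x" if "\<not> ?off y" for x y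
  proof -
    have "\<bar>snd x - fst x\<bar> \<le> \<bar>fst x - fst y\<bar> + \<bar>snd x - snd y\<bar>" using that by linarith
    then have "diag_dist x \<le> linf x y" by (simp add: diag_dist_def linf_def max_def)
    moreover have "linf y x = linf x y" by (simp add: linf_def abs_minus_commute)
    ultimately show ?thesis by simp
  qed
  have "partial_matching D D' Mt" by (simp add: partial_matching_def DU DV)
  moreover have "matching_cost D D' Mt \<le> c"
    unfolding matching_cost_def
  proof (rule Max.boundedI)
    fix a assume "a \<in> {0} \<union> (\<lambda>(x, y). linf x y) ` set_mset Mt
      \<union> diag_dist ` set_mset (D - image_mset fst Mt) \<union> diag_dist ` set_mset (D' - image_mset snd Mt)"
    then consider "a = 0" | x y where "a = linf x y" "(x, y) \<in># Mt"
      | x y where "a = diag_dist x" "(x, y) \<in># U" | x y where "a = diag_dist y" "(x, y) \<in># V"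
      by (auto simp: DU DV)
    then show "a \<le> c"
    proof cases
      case 2
      then show ?thesis using Z(1) by (auto simp: Mt_def)
    next
      case 3
      then have "linf x y \<le> c" "\<not> ?off y" using Z(1) by (auto simp: U_def)
      then show ?thesis using diag[of y x] 3 by linarith
    next
      case 4
      then have "linf x y \<le> c" "\<not> ?off x" using Z(1) by (auto simp: V_def)
      then show ?thesis using diag[of x y] 4 by linarith
    qed (use c in simp)
  qed auto
  \<comment> \<open>Costs are nonnegative because 0 is among the values maximised; hence the infimum
    is at most the cost of \<open>Mt\<close>.\<close>
  moreover have "bdd_below {matching_cost D D' N | N. partial_matching D D' N}"
  proof (rule bdd_belowI)
    fix a assume "a \<in> {matching_cost D D' N | N. partial_matching D D' N}"
    then show "0 \<le> a" by (auto simp: matching_cost_def intro!: Max_ge)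
  qed
  ultimately show ?thesis
    unfolding bottleneck_dist_def by (intro cInf_lower2[of "matching_cost D D' Mt"]) auto
qed

lemma max_pers_ge: "p \<in># D \<Longrightarrow> snd p - fst p \<le> max_pers D"
  by (cases p) (auto simp: max_pers_def intro!: Max_ge image_eqI)

lemma max_pers_le:
  assumes "0 \<le> c" "\<And>p. p \<in># D \<Longrightarrow> snd p - fst p \<le> c"
  shows "max_pers D \<le> c"
  using assms by (auto simp: max_pers_def Max_le_iff)

lemma max_pers_nonneg:
  assumes "\<And>p. p \<in># D \<Longrightarrow> fst p < snd p"
  shows "0 \<le> max_pers D"
proof (cases "D = {#}")
  case False
  then obtain p where "p \<in># D" by blast
  then show ?thesis using max_pers_ge[of p D] assms[of p] by simp
qed (simp add: max_pers_def)

text \<open>Persistence is a difference of two coordinates, each moved by at most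
  \<open>c\<close>.\<close>

lemma max_pers_diff_le:
  assumes close: "diagram_close c D D'" and c: "0 \<le> c"
    and D: "\<And>p. p \<in># D \<Longrightarrow> fst p < snd p" "\<And>p. p \<in># D' \<Longrightarrow> fst p < snd p"
  shows "\<bar>max_pers D - max_pers D'\<bar> \<le> 2 * c"
proof -
  obtain Z where Z: "\<And>x y. (x, y) \<in># Z \<Longrightarrow> linf x y \<le> c"
    "D = {#p \<in># image_mset fst Z. fst p \<noteq> snd p#}" "D' = {#p \<in># image_mset snd Z. fst p \<noteq> snd p#}"
    using diagram_close_pairs[OF close D] by blast
  have pers: "\<bar>(snd x - fst x) - (snd y - fst y)\<bar> \<le> 2 * c" if "(x, y) \<in># Z" for x y
    using Z(1)[OF that] by (auto simp: linf_def)
  have 0: "0 \<le> max_pers D" "0 \<le> max_pers D'" using D max_pers_nonneg by auto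
  \<comment> \<open>A padding point has persistence 0, which is below the maximum even for an empty
    diagram, where \<open>max_pers\<close> is 0.\<close>
  have Zb: "snd x - fst x \<le> max_pers D" "snd y - fst y \<le> max_pers D'" if "(x, y) \<in># Z" for x y
  proof -
    have "x \<in># D \<or> fst x = snd x" "y \<in># D' \<or> fst y = snd y" using that Z(2,3) by force+
    then show "snd x - fst x \<le> max_pers D" "snd y - fst y \<le> max_pers D'"
      using 0 max_pers_ge by auto
  qed
  have "max_pers D \<le> max_pers D' + 2 * c"
  proof (rule max_pers_le)
    fix p assume "p \<in># D"
    then obtain y where y: "(p, y) \<in># Z" by (auto simp: Z(2))
    show "snd p - fst p \<le> max_pers D' + 2 * c" using pers[OF y] Zb(2)[OF y] by linarith
  qed (use 0 c in simp)
  moreover have "max_pers D' \<le> max_pers D + 2 * c"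
  proof (rule max_pers_le)
    fix p assume "p \<in># D'"
    then obtain x where x: "(x, p) \<in># Z" by (auto simp: Z(3))
    show "snd p - fst p \<le> max_pers D + 2 * c" using pers[OF x] Zb(1)[OF x] by linarith
  qed (use 0 c in simp)
  ultimately show ?thesis by linarith
qed

section \<open>Point clouds at small Hausdorff distance\<close>

text \<open>Both Vietoris--Rips filtrations are pulled back to \<open>X \<union> Y\<close> along retractions onto \<open>X\<close> and
  onto \<open>Y\<close> that move points by at most \<open>\<epsilon>\<close>.\<close>

lemma diagram_close_hausdorff:
  fixes d :: "'p \<Rightarrow> 'p \<Rightarrow> real"
  assumes nonneg: "\<And>x y. 0 \<le> d x y" and refl: "\<And>x. d x x = 0" and sym: "\<And>x y. d x y = d y x"
    and tri: "\<And>x y z. d x z \<le> d x y + d y z"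
    and fin: "finite X" "finite Y" and \<epsilon>: "0 \<le> \<epsilon>"
    and XY: "\<And>x. x \<in> X \<Longrightarrow> \<exists>y\<in>Y. d x y \<le> \<epsilon>" and YX: "\<And>y. y \<in> Y \<Longrightarrow> \<exists>x\<in>X. d x y \<le> \<epsilon>"
  shows "diagram_close (2 * \<epsilon>) (dgm1 X d) (dgm1 Y d)"
proof -
  obtain u where u: "\<And>x. x \<in> X \<Longrightarrow> u x \<in> Y \<and> d x (u x) \<le> \<epsilon>" using XY by metis
  obtain v where v: "\<And>y. y \<in> Y \<Longrightarrow> v y \<in> X \<and> d (v y) y \<le> \<epsilon>" using YX by metis
  define g where "g w = (if w \<in> X then w else v w)" for w
  define k where "k w = (if w \<in> Y then w else u w)" for w
  let ?W = "X \<union> Y"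
  have gk: "d (g w) (k w) \<le> \<epsilon>" if "w \<in> ?W" for w
    using that u v \<epsilon> refl by (auto simp: g_def k_def)
  \<comment> \<open>The triangle inequality around the quadrilateral \<open>g x\<close>,
    \<open>k x\<close>, \<open>k y\<close>, \<open>g y\<close>, whose sides joining \<open>g\<close>
    to \<open>k\<close> have length at most \<open>\<epsilon>\<close>.\<close>
  have "\<bar>d (g x) (g y) - d (k x) (k y)\<bar> \<le> 2 * \<epsilon>" if "x \<in> ?W" "y \<in> ?W" for x y
    using tri[of "g x" "g y" "k x"] tri[of "k x" "g y" "k y"] tri[of "k x" "k y" "g x"]
      tri[of "g x" "k y" "g y"] sym[of "k x" "g x"] sym[of "k y" "g y"] gk[OF that(1)] gk[OF that(2)]
    by linarith
  then have "diagram_close (2 * \<epsilon>) (dgm1 ?W (\<lambda>x y. d (g x) (g y))) (dgm1 ?W (\<lambda>x y. d (k x) (k y)))"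
    using fin \<epsilon> nonneg by (intro diagram_close_dgm1) auto
  moreover have "dgm1 ?W (\<lambda>x y. d (g x) (g y)) = dgm1 X d"
    using fin v by (intro dgm1_retract) (auto simp: g_def)
  moreover have "dgm1 ?W (\<lambda>x y. d (k x) (k y)) = dgm1 Y d"
    using fin u by (intro dgm1_retract) (auto simp: k_def)
  ultimately show ?thesis by simp
qed

section \<open>Euclidean and Hausdorff distances of sliding windows\<close>

lemma eucl_dist_L2_set: "eucl_dist M x y = L2_set (\<lambda>i. x i - y i) {..M}"
  by (simp add: eucl_dist_def L2_set_def)

lemma eucl_dist_nonneg: "0 \<le> eucl_dist M x y"
  by (simp add: eucl_dist_L2_set)

lemma eucl_dist_commute: "eucl_dist M x y = eucl_dist M y x"
  by (simp add: eucl_dist_def power2_commute)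

lemma eucl_dist_triangle: "eucl_dist M x z \<le> eucl_dist M x y + eucl_dist M y z"
  using L2_set_triangle_ineq[of "\<lambda>i. x i - y i" "\<lambda>i. y i - z i" "{..M}"]
  by (simp add: eucl_dist_L2_set)

text \<open>Thickenings use open balls, so \<open>\<epsilon>\<close> itself may fail to be
  admissible, while every larger radius is.\<close>

lemma hausdorff_dist_le:
  assumes "0 \<le> \<epsilon>"
    and "\<And>x. x \<in> X \<Longrightarrow> \<exists>y\<in>Y. eucl_dist M x y \<le> \<epsilon>" and "\<And>y. y \<in> Y \<Longrightarrow> \<exists>x\<in>X. eucl_dist M x y \<le> \<epsilon>"
  shows "hausdorff_dist M X Y \<le> \<epsilon>"
proof (rule field_le_epsilon)
  fix e :: real assume e: "0 < e"
  have "X \<subseteq> thicken M Y (\<epsilon> + e)"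
  proof
    fix x assume "x \<in> X"
    then obtain y where "y \<in> Y" "eucl_dist M y x \<le> \<epsilon>" using assms(2) eucl_dist_commute by metis
    then show "x \<in> thicken M Y (\<epsilon> + e)" using e by (force simp: thicken_def)
  qed
  moreover have "Y \<subseteq> thicken M X (\<epsilon> + e)"
    using assms(3) e by (force simp: thicken_def)
  ultimately show "hausdorff_dist M X Y \<le> \<epsilon> + e"
    unfolding hausdorff_dist_def using assms(1) e
    by (intro cInf_lower) (auto intro!: bdd_belowI[of _ 0])
qed

text \<open>The mean value theorem is applied in each coordinate; the gaps between arguments are all
  bounded by \<open>(M + 1) * (\<tau>1 - \<tau>2)\<close>, which then factors out of the
  norm.\<close>

lemma sw_embed_dist_le:
  fixes f :: "real \<Rightarrow> real"
  assumes diff: "\<forall>x. f differentiable (at x)" and \<tau>: "\<tau>2 < \<tau>1"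
  obtains c where "\<And>i. i \<in> {2..M + 1} \<Longrightarrow> t + (real i - 1) * \<tau>2 < c i \<and> c i < t + (real i - 1) * \<tau>1"
    "eucl_dist M (sw_embed f \<tau>1 M t) (sw_embed f \<tau>2 M t)
      \<le> ((real M + 1) * (\<tau>1 - \<tau>2)) * sqrt (\<Sum>i\<in>{2..M+1}. \<bar>deriv f (c i)\<bar>\<^sup>2)"
proof -
  let ?a = "\<lambda>i. t + (real i - 1) * \<tau>2" and ?b = "\<lambda>i. t + (real i - 1) * \<tau>1"
  have "\<exists>c. ?a i < c \<and> c < ?b i \<and> f (?b i) - f (?a i) = (?b i - ?a i) * deriv f c"
    if "i \<in> {2..M + 1}" for i
  proof -
    have "?a i < ?b i" using that \<tau> by auto
    moreover have "DERIV f x :> deriv f x" for x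
      using diff by (simp add: DERIV_deriv_iff_real_differentiable)
    ultimately show ?thesis using MVT2[of "?a i" "?b i" f "deriv f"] by blast
  qed
  then obtain c where c: "\<And>i. i \<in> {2..M + 1} \<Longrightarrow>
      ?a i < c i \<and> c i < ?b i \<and> f (?b i) - f (?a i) = (?b i - ?a i) * deriv f (c i)"
    by metis
  let ?\<Delta> = "(real M + 1) * (\<tau>1 - \<tau>2)"
  let ?x = "sw_embed f \<tau>1 M t" and ?y = "sw_embed f \<tau>2 M t"
  \<comment> \<open>Coordinates are numbered from 0 but intermediate points from 2, so coordinate
    \<open>i\<close> belongs to \<open>c (Suc i)\<close>.\<close>
  have term_le: "(?x i - ?y i)\<^sup>2 \<le> ?\<Delta>\<^sup>2 * \<bar>deriv f (c (Suc i))\<bar>\<^sup>2" if i: "i \<in> {1..M}" for i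
  proof -
    have "?x i - ?y i = (real i * (\<tau>1 - \<tau>2)) * deriv f (c (Suc i))"
      using c[of "Suc i"] i by (simp add: sw_embed_def algebra_simps)
    moreover have "(real i * (\<tau>1 - \<tau>2))\<^sup>2 \<le> ?\<Delta>\<^sup>2"
      using i \<tau> by (intro power_mono mult_right_mono) auto
    ultimately show ?thesis by (simp add: power_mult_distrib mult_right_mono)
  qed
  \<comment> \<open>Coordinate 0 is \<open>f t\<close> in both embeddings.\<close>
  have "(\<Sum>i\<le>M. (?x i - ?y i)\<^sup>2) = (\<Sum>i\<in>{1..M}. (?x i - ?y i)\<^sup>2)"
    by (rule sum.mono_neutral_right) (auto simp: sw_embed_def not_less_eq_eq)
  also have "\<dots> \<le> (\<Sum>i\<in>{1..M}. ?\<Delta>\<^sup>2 * \<bar>deriv f (c (Suc i))\<bar>\<^sup>2)"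
    by (rule sum_mono) (rule term_le)
  also have "\<dots> = ?\<Delta>\<^sup>2 * (\<Sum>i\<in>{2..M+1}. \<bar>deriv f (c i)\<bar>\<^sup>2)"
    using sum.shift_bounds_cl_Suc_ivl[of "\<lambda>i. \<bar>deriv f (c i)\<bar>\<^sup>2" 1 M]
    by (simp add: sum_distrib_left numeral_2_eq_2)
  finally have "eucl_dist M ?x ?y \<le> sqrt (?\<Delta>\<^sup>2 * (\<Sum>i\<in>{2..M+1}. \<bar>deriv f (c i)\<bar>\<^sup>2))"
    by (simp add: eucl_dist_def)
  also have "\<dots> = ?\<Delta> * sqrt (\<Sum>i\<in>{2..M+1}. \<bar>deriv f (c i)\<bar>\<^sup>2)"
    using \<tau> by (simp add: real_sqrt_mult)
  finally show ?thesis using c by (intro that[of c]) auto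
qed

theorem mainTheorem2:
  fixes M w1 w21 w22 :: nat and f1 :: "real \<Rightarrow> real" and T :: "real set"
  assumes "w1 > 0" "w21 > 0" "w22 > 0"
    and "2 * pi / w22 < 2 * pi / w21" "2 * pi / w21 \<le> 2 * pi / w1"
    and "\<forall>x. f1 differentiable (at x)"
    and "\<forall>x. f1 (x + 2 * pi / w1) = f1 x"
    and "finite T" "T \<noteq> {}" "T \<subseteq> {0 .. 2 * pi / w1}"
  shows "let \<tau>1 = 2 * pi / (real w21 * (real M + 1));
             \<tau>2 = 2 * pi / (real w22 * (real M + 1));
             X1 = cond_sw_embedding f1 \<tau>1 M T;
             X2 = cond_sw_embedding f1 \<tau>2 M T;
             \<Delta> = \<bar>2 * pi / w21 - 2 * pi / w22\<bar>
         in \<exists>t\<in>T. \<exists>c :: nat \<Rightarrow> real.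
              (\<forall>i\<in>{2..M+1}. t + (real i - 1) * \<tau>2 < c i \<and> c i < t + (real i - 1) * \<tau>1) \<and>
              (let S = sqrt (\<Sum>i\<in>{2..M+1}. \<bar>deriv f1 (c i)\<bar>\<^sup>2) in
                 hausdorff_dist M X1 X2 \<le> sqrt (real M + 1) * \<Delta> * S \<and>
                 bottleneck_dist (dgm1_pc M X1) (dgm1_pc M X2) \<le> 2 * sqrt (real M + 1) * \<Delta> * S \<and>
                 \<bar>max_pers (dgm1_pc M X1) - max_pers (dgm1_pc M X2)\<bar> \<le> 4 * sqrt (real M + 1) * \<Delta> * S \<and>
                 \<bar>cond_score f1 \<tau>1 M T - cond_score f1 \<tau>2 M T\<bar> \<le> 4 * sqrt ((real M + 1) / 3) * \<Delta> * S)"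
proof -
  define \<tau>1 where "\<tau>1 = 2 * pi / (real w21 * (real M + 1))"
  define \<tau>2 where "\<tau>2 = 2 * pi / (real w22 * (real M + 1))"
  define \<Delta> where "\<Delta> = \<bar>2 * pi / w21 - 2 * pi / w22\<bar>"
  define X1 where "X1 = cond_sw_embedding f1 \<tau>1 M T"
  define X2 where "X2 = cond_sw_embedding f1 \<tau>2 M T"
  have M1: "(real M + 1) * \<tau>1 = 2 * pi / w21" "(real M + 1) * \<tau>2 = 2 * pi / w22"
  proof -
    have "a * (b / (w * a)) = b / w" if "a \<noteq> 0" for a b w :: real using that by simp
    from this[of "real M + 1"]
    show "(real M + 1) * \<tau>1 = 2 * pi / w21" "(real M + 1) * \<tau>2 = 2 * pi / w22"
      unfolding \<tau>1_def \<tau>2_def by (metis add_pos_nonneg add.commute of_nat_0_le_iff less_irrefl zero_less_one)+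
  qed
  then have \<Delta>: "\<Delta> = (real M + 1) * (\<tau>1 - \<tau>2)"
    using assms(4) by (simp add: \<Delta>_def right_diff_distrib)
  have "(real M + 1) * \<tau>2 < (real M + 1) * \<tau>1" using assms(4) M1 by simp
  then have \<tau>: "\<tau>2 < \<tau>1" by (simp add: mult_less_cancel_left)
  let ?dist = "\<lambda>t. eucl_dist M (sw_embed f1 \<tau>1 M t) (sw_embed f1 \<tau>2 M t)"
  \<comment> \<open>The largest displacement bounds all the others, so intermediate points at a
    single maximising \<open>t\<close> control the whole clouds.\<close>
  define \<epsilon> where "\<epsilon> = Max (?dist ` T)"
  have dist_le: "?dist s \<le> \<epsilon>" if "s \<in> T" for s using assms(8) that by (simp add: \<epsilon>_def)
  have "\<epsilon> \<in> ?dist ` T" unfolding \<epsilon>_def using assms(8,9) by (intro Max_in) auto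
  then obtain t where t: "t \<in> T" "\<epsilon> = ?dist t" by blast
  then have \<epsilon>0: "0 \<le> \<epsilon>" by (simp add: eucl_dist_nonneg)
  obtain c where c: "\<And>i. i \<in> {2..M + 1} \<Longrightarrow> t + (real i - 1) * \<tau>2 < c i \<and> c i < t + (real i - 1) * \<tau>1"
    and le: "?dist t \<le> ((real M + 1) * (\<tau>1 - \<tau>2)) * sqrt (\<Sum>i\<in>{2..M+1}. \<bar>deriv f1 (c i)\<bar>\<^sup>2)"
    using sw_embed_dist_le[OF assms(6) \<tau>] by blast
  define S where "S = sqrt (\<Sum>i\<in>{2..M+1}. \<bar>deriv f1 (c i)\<bar>\<^sup>2)"
  have S0: "0 \<le> S" by (simp add: S_def sum_nonneg)
  have \<epsilon>S: "\<epsilon> \<le> sqrt (real M + 1) * \<Delta> * S"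
  proof -
    \<comment> \<open>The mean value estimate gives \<open>\<Delta> * S\<close>, and
      \<open>sqrt (M + 1)\<close> is at least 1.\<close>
    have "\<epsilon> \<le> 1 * (\<Delta> * S)" using le t(2) by (simp add: \<Delta> S_def)
    also have "\<dots> \<le> sqrt (real M + 1) * (\<Delta> * S)"
      using S0 by (intro mult_right_mono) (auto simp: \<Delta>_def)
    finally show ?thesis by (simp add: mult.assoc)
  qed
  have X12: "\<exists>y\<in>X2. eucl_dist M x y \<le> \<epsilon>" if "x \<in> X1" for x
    using that dist_le by (auto simp: X1_def X2_def cond_sw_embedding_def)
  have X21: "\<exists>x\<in>X1. eucl_dist M x y \<le> \<epsilon>" if "y \<in> X2" for y
    using that dist_le by (auto simp: X1_def X2_def cond_sw_embedding_def)
  have fin: "finite X1" "finite X2"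
    using assms(8) by (simp_all add: X1_def X2_def cond_sw_embedding_def)
  have close: "diagram_close (2 * \<epsilon>) (dgm1_pc M X1) (dgm1_pc M X2)"
    unfolding dgm1_pc_def
    by (rule diagram_close_hausdorff[OF eucl_dist_nonneg _ eucl_dist_commute eucl_dist_triangle
          fin \<epsilon>0 X12 X21]) (simp add: eucl_dist_def)
  have D: "\<And>p. p \<in># dgm1_pc M X1 \<Longrightarrow> fst p < snd p" "\<And>p. p \<in># dgm1_pc M X2 \<Longrightarrow> fst p < snd p"
    using dgm1_elem(3) fin unfolding dgm1_pc_def by blast+
  have H: "hausdorff_dist M X1 X2 \<le> \<epsilon>"
    by (rule hausdorff_dist_le[OF \<epsilon>0 X12 X21])
  have B: "bottleneck_dist (dgm1_pc M X1) (dgm1_pc M X2) \<le> 2 * \<epsilon>"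
    using bottleneck_dist_le[OF close _ D] \<epsilon>0 by simp
  \<comment> \<open>One factor 2 comes from the closeness \<open>2 * \<epsilon>\<close>, the other
    from the two coordinates entering a persistence.\<close>
  have P: "\<bar>max_pers (dgm1_pc M X1) - max_pers (dgm1_pc M X2)\<bar> \<le> 4 * \<epsilon>"
    using max_pers_diff_le[OF close _ D] \<epsilon>0 by simp
  then have P': "\<bar>max_pers (dgm1_pc M X1) - max_pers (dgm1_pc M X2)\<bar> \<le> 4 * sqrt (real M + 1) * \<Delta> * S"
    using \<epsilon>S by linarith
  have "\<bar>cond_score f1 \<tau>1 M T - cond_score f1 \<tau>2 M T\<bar>
    = \<bar>max_pers (dgm1_pc M X1) - max_pers (dgm1_pc M X2)\<bar> / sqrt 3"
    by (simp add: cond_score_def X1_def X2_def flip: diff_divide_distrib)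
  also have "\<dots> \<le> (4 * sqrt (real M + 1) * \<Delta> * S) / sqrt 3"
    by (rule divide_right_mono[OF P']) simp
  also have "\<dots> = 4 * sqrt ((real M + 1) / 3) * \<Delta> * S" by (simp add: real_sqrt_divide)
  finally have "\<bar>cond_score f1 \<tau>1 M T - cond_score f1 \<tau>2 M T\<bar> \<le> 4 * sqrt ((real M + 1) / 3) * \<Delta> * S" .
  moreover have "hausdorff_dist M X1 X2 \<le> sqrt (real M + 1) * \<Delta> * S" using H \<epsilon>S by simp
  moreover have "bottleneck_dist (dgm1_pc M X1) (dgm1_pc M X2) \<le> 2 * sqrt (real M + 1) * \<Delta> * S"
    using B \<epsilon>S by linarith
  ultimately show ?thesis
    unfolding Let_def \<tau>1_def[symmetric] \<tau>2_def[symmetric] X1_def[symmetric] X2_def[symmetric]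
      \<Delta>_def[symmetric]
    using t(1) c P' unfolding S_def by blast
qed

end
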